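(* Let $k$ be a field of characteristic zero and $n$ a natural number. The symmetric algebra $S(T_n)$ on $n$-coloured trees has a family of graded connected Hopf algebra structures (with respect to its usual multiplication), indexed by sequences $(q_{11},\dots,q_{1n},q_{21},\dots,q_{2n})\in k^{2n}$, where the grading is by the number of vertices. For each such sequence, an inductive description of the coproduct $\Delta$ is given, for all $n$-coloured forests $f_1,\dots,f_n$, by \[ \Delta(\lambda(f_1,\dots,f_n))=\sum q_{11}^{|f_1'|}\cdots q_{1n}^{|f_n'|}\; f_1'\cdots f_n'\otimes\lambda(f_1'',\dots,f_n'')+\sum \lambda(f_1',\dots,f_n')\otimes q_{21}^{|f_1''|}\cdots q_{2n}^{|f_n''|}\; f_1''\cdots f_n'' . \]
   Context: A rooted tree is an isomorphism class of finite posets which have a minimum element (the root), and in which $y\neq z$, $y<x$, $z<x$ imply $y<z$ or $z<y$. Elements are called vertices; a pair $v<w$ with no $x$ satisfying $v<x<w$ is called an edge. An $n$-coloured tree is an isomorphism class of such posets equipped with a function from the set of edges to $\{1,\dots,n\}$ (isomorphisms respect colours). $T_n$ is the $k$-vector space with basis the set of $n$-coloured trees. An $n$-coloured forest is a finite, possibly empty, multiset of $n$-coloured trees. $S(T_n)$ has as basis the $n$-coloured forests, with product the disjoint union and unit the empty forest. The linear map $\lambda:S(T_n)^{\otimes n}\to S(T_n)$ sends an $n$-tuple of forests $(f_1,\dots,f_n)$ to the tree obtained by adding a new root and connecting it to each root of each tree of $f_i$ by an edge of colour $i$. $|f|$ denotes the number of vertices of a forest $f$. The notation $\Delta(f_i)=\sum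 f_i'\otimes f_i''$ (Sweedler notation, for an expansion in the basis of forests, with $f_i',f_i''$ homogeneous for $|\cdot|$) is used, and the sums in the formula run over the expansions of $\Delta(f_1),\dots,\Delta(f_n)$ simultaneously. Convention: $q^0=1$ for all $q\in k$, including $q=0$. *)

theory Defs
  imports
    "HOL-Library.Poly_Mapping"
    "HOL-Library.Product_Plus"
    "HOL-Library.Multiset"
    "HOL-Library.FuncSet"
    "HOL-Library.Nat_Bijection"
begin

section \<open>Coloured trees and forests\<close>

text \<open>
  Every finite poset is isomorphic to one whose elements are natural numbers, so it suffices to
  take vertices in \<^typ>\<open>nat\<close>. The order \<open>le\<close> is the reflexive one.
  The colouring is a total function of which only the values on edges are relevant.
\<close>

datatype cposet = CPoset (verts: "nat set") (le: "nat rel") (col: "nat \<times> nat \<Rightarrow> nat")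

definition less_in :: "cposet \<Rightarrow> nat \<Rightarrow> nat \<Rightarrow> bool" where
  "less_in P x y \<longleftrightarrow> (x, y) \<in> le P \<and> x \<noteq> y"

definition edges :: "cposet \<Rightarrow> (nat \<times> nat) set" where
  "edges P = {(v, w). less_in P v w \<and> (\<nexists>x. less_in P v x \<and> less_in P x w)}"

definition tree_poset :: "cposet \<Rightarrow> bool" where
  "tree_poset P \<longleftrightarrow>
     finite (verts P) \<and> partial_order_on (verts P) (le P) \<and>
     (\<exists>r\<in>verts P. \<forall>x\<in>verts P. (r, x) \<in> le P) \<and>
     (\<forall>x\<in>verts P. \<forall>y\<in>verts P. \<forall>z\<in>verts P.
        y \<noteq> z \<longrightarrow> less_in P y x \<longrightarrow> less_in P z x \<longrightarrow> less_in P y z \<or> less_in P z y)"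

definition cposet_iso :: "cposet \<Rightarrow> cposet \<Rightarrow> bool" where
  "cposet_iso P Q \<longleftrightarrow>
     (\<exists>\<phi>. bij_betw \<phi> (verts P) (verts Q) \<and>
          (\<forall>x\<in>verts P. \<forall>y\<in>verts P. (x, y) \<in> le P \<longleftrightarrow> (\<phi> x, \<phi> y) \<in> le Q) \<and>
          (\<forall>(x, y)\<in>edges P. col Q (\<phi> x, \<phi> y) = col P (x, y)))"

type_synonym ctree = "cposet set"
type_synonym cforest = "ctree multiset"

definition iso_class :: "cposet \<Rightarrow> ctree" where
  "iso_class P = {Q. tree_poset Q \<and> cposet_iso P Q}"

definition trees :: "nat \<Rightarrow> ctree set" where
  "trees n = {iso_class P | P. tree_poset P \<and> col P ` edges P \<subseteq> {1..n}}"

definition forests :: "nat \<Rightarrow> cforest set" where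
  "forests n = {F. set_mset F \<subseteq> trees n}"

definition rep :: "ctree \<Rightarrow> cposet" where
  "rep t = (SOME P. P \<in> t)"

definition tree_size :: "ctree \<Rightarrow> nat" where
  "tree_size t = card (verts (rep t))"

definition forest_size :: "cforest \<Rightarrow> nat" where
  "forest_size F = (\<Sum>t\<in>#F. tree_size t)"

text \<open>
  Grafting: \<open>join_root [(c\<^sub>0, P\<^sub>0), \<dots>]\<close> is the disjoint union of the posets \<open>P\<^sub>j\<close> together with a new
  root \<open>0\<close>, where the edge from \<open>0\<close> to the root of \<open>P\<^sub>j\<close> has colour \<open>c\<^sub>j\<close>. The vertex \<open>v\<close> of the
  \<open>j\<close>-th poset becomes \<open>vertex_copy j v\<close>, and these codes are pairwise distinct and nonzero.
\<close>

definition vertex_copy :: "nat \<Rightarrow> nat \<Rightarrow> nat" where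
  "vertex_copy j v = Suc (prod_encode (j, v))"

definition join_root :: "(nat \<times> cposet) list \<Rightarrow> cposet" where
  "join_root xs =
    (let V = insert 0 (\<Union>j<length xs. vertex_copy j ` verts (snd (xs ! j)))
     in CPoset V
          ({0} \<times> V \<union>
           (\<Union>j<length xs. map_prod (vertex_copy j) (vertex_copy j) ` le (snd (xs ! j))))
          (\<lambda>(x, y). let (j, w) = prod_decode (y - 1) in
             if x = 0 then fst (xs ! j)
             else col (snd (xs ! j)) (snd (prod_decode (x - 1)), w)))"

text \<open>
  The list of all trees of \<open>f 1, \<dots>, f n\<close>, each paired with the index of its forest. The order
  in which the trees are listed does not affect the isomorphism class of the grafted tree.
\<close>

definition branches :: "nat \<Rightarrow> (nat \<Rightarrow> cforest) \<Rightarrow> (nat \<times> ctree) list" where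
  "branches n f = (SOME xs. mset xs = (\<Sum>i\<in>{1..n}. image_mset (Pair i) (f i)))"

definition graft :: "nat \<Rightarrow> (nat \<Rightarrow> cforest) \<Rightarrow> ctree" where
  "graft n f = iso_class (join_root (map (map_prod id rep) (branches n f)))"


section \<open>Free modules and their tensor products\<close>

text \<open>
  The \<open>k\<close>-module with basis \<open>B\<close> consists of the finitely supported functions with support in \<open>B\<close>,
  and the tensor product of the modules with bases \<open>B\<close> and \<open>C\<close> is the one with basis \<open>B \<times> C\<close>.
  If the basis is a commutative monoid, then the product of \<^typ>\<open>'b \<Rightarrow>\<^sub>0 'k::comm_ring_1\<close> extends its
  addition bilinearly. For forests this is disjoint union, and for pairs of forests it is
  the product of the tensor square, \<open>(a \<otimes> b) * (c \<otimes> d) = a * c \<otimes> b * d\<close>.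
\<close>

definition free_mod :: "'b set \<Rightarrow> ('b \<Rightarrow>\<^sub>0 'k::comm_ring_1) set" where
  "free_mod B = {x. Poly_Mapping.keys x \<subseteq> B}"

definition basis :: "'b \<Rightarrow> ('b \<Rightarrow>\<^sub>0 'k::comm_ring_1)" where
  "basis b = Poly_Mapping.single b 1"

definition smul :: "'k::comm_ring_1 \<Rightarrow> ('b \<Rightarrow>\<^sub>0 'k) \<Rightarrow> ('b \<Rightarrow>\<^sub>0 'k)" (infixr "*\<^sub>k" 75) where
  "c *\<^sub>k x = Poly_Mapping.map ((*) c) x"

definition tensor :: "('b \<Rightarrow>\<^sub>0 'k::comm_ring_1) \<Rightarrow> ('c \<Rightarrow>\<^sub>0 'k) \<Rightarrow> (('b \<times> 'c) \<Rightarrow>\<^sub>0 'k)"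
    (infixr "\<otimes>" 70) where
  "x \<otimes> y = (\<Sum>a\<in>Poly_Mapping.keys x. \<Sum>b\<in>Poly_Mapping.keys y.
      Poly_Mapping.single (a, b) (Poly_Mapping.lookup x a * Poly_Mapping.lookup y b))"

definition lin_ext :: "('b \<Rightarrow> ('c \<Rightarrow>\<^sub>0 'k::comm_ring_1)) \<Rightarrow> ('b \<Rightarrow>\<^sub>0 'k) \<Rightarrow> ('c \<Rightarrow>\<^sub>0 'k)" where
  "lin_ext g x = (\<Sum>b\<in>Poly_Mapping.keys x. Poly_Mapping.lookup x b *\<^sub>k g b)"

definition tensor_map ::
    "(('a \<Rightarrow>\<^sub>0 'k::comm_ring_1) \<Rightarrow> ('b \<Rightarrow>\<^sub>0 'k)) \<Rightarrow> (('c \<Rightarrow>\<^sub>0 'k) \<Rightarrow> ('d \<Rightarrow>\<^sub>0 'k))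
      \<Rightarrow> (('a \<times> 'c) \<Rightarrow>\<^sub>0 'k) \<Rightarrow> (('b \<times> 'd) \<Rightarrow>\<^sub>0 'k)" where
  "tensor_map f g = lin_ext (\<lambda>(a, c). f (basis a) \<otimes> g (basis c))"

definition tensor_assoc ::
    "((('a \<times> 'b) \<times> 'c) \<Rightarrow>\<^sub>0 'k::comm_ring_1) \<Rightarrow> (('a \<times> ('b \<times> 'c)) \<Rightarrow>\<^sub>0 'k)" where
  "tensor_assoc = lin_ext (\<lambda>((a, b), c). basis (a, (b, c)))"

definition mult_map :: "(('b \<times> 'b) \<Rightarrow>\<^sub>0 'k::comm_ring_1) \<Rightarrow> ('b::comm_monoid_add \<Rightarrow>\<^sub>0 'k)" where
  "mult_map = lin_ext (\<lambda>(a, b). basis a * basis b)"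

text \<open>
  \<open>\<epsilon> \<otimes> id\<close> and \<open>id \<otimes> \<epsilon>\<close> for a linear form \<open>\<epsilon>\<close>, followed by \<open>k \<otimes> A \<cong> A\<close> and \<open>A \<otimes> k \<cong> A\<close>:
\<close>

definition counit_left ::
    "(('b \<Rightarrow>\<^sub>0 'k::comm_ring_1) \<Rightarrow> 'k) \<Rightarrow> (('b \<times> 'b) \<Rightarrow>\<^sub>0 'k) \<Rightarrow> ('b \<Rightarrow>\<^sub>0 'k)" where
  "counit_left \<epsilon> = lin_ext (\<lambda>(a, b). \<epsilon> (basis a) *\<^sub>k basis b)"

definition counit_right ::
    "(('b \<Rightarrow>\<^sub>0 'k::comm_ring_1) \<Rightarrow> 'k) \<Rightarrow> (('b \<times> 'b) \<Rightarrow>\<^sub>0 'k) \<Rightarrow> ('b \<Rightarrow>\<^sub>0 'k)" where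
  "counit_right \<epsilon> = lin_ext (\<lambda>(a, b). \<epsilon> (basis b) *\<^sub>k basis a)"


section \<open>Graded connected Hopf algebras\<close>

definition linear_map_on ::
    "('b \<Rightarrow>\<^sub>0 'k::comm_ring_1) set \<Rightarrow> (('b \<Rightarrow>\<^sub>0 'k) \<Rightarrow> ('c \<Rightarrow>\<^sub>0 'k)) \<Rightarrow> bool" where
  "linear_map_on A f \<longleftrightarrow>
     (\<forall>x\<in>A. \<forall>y\<in>A. f (x + y) = f x + f y) \<and> (\<forall>c. \<forall>x\<in>A. f (c *\<^sub>k x) = c *\<^sub>k f x)"

definition linear_form_on ::
    "('b \<Rightarrow>\<^sub>0 'k::comm_ring_1) set \<Rightarrow> (('b \<Rightarrow>\<^sub>0 'k) \<Rightarrow> 'k) \<Rightarrow> bool" where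
  "linear_form_on A f \<longleftrightarrow>
     (\<forall>x\<in>A. \<forall>y\<in>A. f (x + y) = f x + f y) \<and> (\<forall>c. \<forall>x\<in>A. f (c *\<^sub>k x) = c * f x)"

definition multiplicative_on :: "'a::monoid_mult set \<Rightarrow> ('a \<Rightarrow> 'c::monoid_mult) \<Rightarrow> bool" where
  "multiplicative_on A f \<longleftrightarrow> f 1 = 1 \<and> (\<forall>x\<in>A. \<forall>y\<in>A. f (x * y) = f x * f y)"

text \<open>
  A Hopf algebra on the free module with basis \<open>B\<close>, whose multiplication is that of
  \<^typ>\<open>'b \<Rightarrow>\<^sub>0 'k\<close>, with coproduct \<open>\<Delta>\<close>, counit \<open>\<epsilon>\<close> and antipode \<open>S\<close>. The grading is given by
  a degree function on the basis. Associativity and unitality of the product, and the direct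
  sum decomposition into homogeneous components, hold by construction.
\<close>

definition homogeneous :: "'b set \<Rightarrow> ('b \<Rightarrow> nat) \<Rightarrow> nat \<Rightarrow> ('b \<Rightarrow>\<^sub>0 'k::comm_ring_1) set" where
  "homogeneous B deg m = free_mod {b \<in> B. deg b = m}"

locale graded_connected_hopf_algebra =
  fixes B :: "'b::comm_monoid_add set"
    and deg :: "'b \<Rightarrow> nat"
    and \<Delta> :: "('b \<Rightarrow>\<^sub>0 'k::field) \<Rightarrow> (('b \<times> 'b) \<Rightarrow>\<^sub>0 'k)"
    and \<epsilon> :: "('b \<Rightarrow>\<^sub>0 'k) \<Rightarrow> 'k"
    and S :: "('b \<Rightarrow>\<^sub>0 'k) \<Rightarrow> ('b \<Rightarrow>\<^sub>0 'k)"
  assumes one_closed: "(1 :: 'b \<Rightarrow>\<^sub>0 'k) \<in> free_mod B"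
    and mult_closed: "\<And>x y :: 'b \<Rightarrow>\<^sub>0 'k. \<lbrakk>x \<in> free_mod B; y \<in> free_mod B\<rbrakk> \<Longrightarrow> x * y \<in> free_mod B"
    and coproduct_closed: "\<And>x. x \<in> free_mod B \<Longrightarrow> \<Delta> x \<in> free_mod (B \<times> B)"
    and coproduct_linear: "linear_map_on (free_mod B) \<Delta>"
    and coproduct_multiplicative: "multiplicative_on (free_mod B) \<Delta>"
    and counit_linear: "linear_form_on (free_mod B) \<epsilon>"
    and counit_multiplicative: "multiplicative_on (free_mod B) \<epsilon>"
    and coassociative: "\<And>x. x \<in> free_mod B \<Longrightarrow>
          tensor_assoc (tensor_map \<Delta> id (\<Delta> x)) = tensor_map id \<Delta> (\<Delta> x)"
    and counital_left: "\<And>x. x \<in> free_mod B \<Longrightarrow> counit_left \<epsilon> (\<Delta> x) = x"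
    and counital_right: "\<And>x. x \<in> free_mod B \<Longrightarrow> counit_right \<epsilon> (\<Delta> x) = x"
    and antipode_closed: "\<And>x. x \<in> free_mod B \<Longrightarrow> S x \<in> free_mod B"
    and antipode_linear: "linear_map_on (free_mod B) S"
    and antipode_left: "\<And>x. x \<in> free_mod B \<Longrightarrow> mult_map (tensor_map S id (\<Delta> x)) = \<epsilon> x *\<^sub>k 1"
    and antipode_right: "\<And>x. x \<in> free_mod B \<Longrightarrow> mult_map (tensor_map id S (\<Delta> x)) = \<epsilon> x *\<^sub>k 1"
    and one_graded: "(1 :: 'b \<Rightarrow>\<^sub>0 'k) \<in> homogeneous B deg 0"
    and mult_graded: "\<And>(x :: 'b \<Rightarrow>\<^sub>0 'k) y i j.
          \<lbrakk>x \<in> homogeneous B deg i; y \<in> homogeneous B deg j\<rbrakk> \<Longrightarrow> x * y \<in> homogeneous B deg (i + j)"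
    and coproduct_graded: "\<And>x m. x \<in> homogeneous B deg m \<Longrightarrow>
          \<Delta> x \<in> homogeneous (B \<times> B) (\<lambda>(a, b). deg a + deg b) m"
    and counit_graded: "\<And>x m. \<lbrakk>x \<in> homogeneous B deg m; m > 0\<rbrakk> \<Longrightarrow> \<epsilon> x = 0"
    and antipode_graded: "\<And>x m. x \<in> homogeneous B deg m \<Longrightarrow> S x \<in> homogeneous B deg m"
    and connected: "(homogeneous B deg 0 :: ('b \<Rightarrow>\<^sub>0 'k) set) = {c *\<^sub>k 1 | c. True}"


section \<open>The inductive formula for the coproduct\<close>

definition symm_alg :: "nat \<Rightarrow> (cforest \<Rightarrow>\<^sub>0 'k::comm_ring_1) set" where
  "symm_alg n = free_mod (forests n)"

text \<open>The map \<open>\<lambda>\<close> on basis elements, i.e. on \<open>n\<close>-tuples of forests \<open>f 1, \<dots>, f n\<close>:\<close>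

definition lam :: "nat \<Rightarrow> (nat \<Rightarrow> cforest) \<Rightarrow> (cforest \<Rightarrow>\<^sub>0 'k::comm_ring_1)" where
  "lam n f = basis {#graft n f#}"

text \<open>
  The simultaneous Sweedler sums run over all choices \<open>p\<close> of one basis element
  \<open>p i = (f\<^sub>i', f\<^sub>i'')\<close> from the expansion of each \<open>\<Delta> (f i)\<close>; the coefficients of
  the expansions are multiplied.
\<close>

definition coproduct_formula ::
    "nat \<Rightarrow> (nat \<Rightarrow> 'k) \<Rightarrow> (nat \<Rightarrow> 'k) \<Rightarrow>
      ((cforest \<Rightarrow>\<^sub>0 'k::comm_ring_1) \<Rightarrow> ((cforest \<times> cforest) \<Rightarrow>\<^sub>0 'k)) \<Rightarrow> bool" where
  "coproduct_formula n q1 q2 \<Delta> \<longleftrightarrow>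
    (\<forall>f. (\<forall>i\<in>{1..n}. f i \<in> forests n) \<longrightarrow>
      (let choices = (\<Pi>\<^sub>E i\<in>{1..n}. Poly_Mapping.keys (\<Delta> (basis (f i))));
           coef = (\<lambda>p. \<Prod>i\<in>{1..n}. Poly_Mapping.lookup (\<Delta> (basis (f i))) (p i))
       in \<Delta> (lam n f) =
            (\<Sum>p\<in>choices. coef p *\<^sub>k
               (((\<Prod>i\<in>{1..n}. q1 i ^ forest_size (fst (p i))) *\<^sub>k (\<Prod>i\<in>{1..n}. basis (fst (p i))))
                \<otimes> lam n (\<lambda>i. snd (p i)))) +
            (\<Sum>p\<in>choices. coef p *\<^sub>k
               (lam n (\<lambda>i. fst (p i)) \<otimes>
                ((\<Prod>i\<in>{1..n}. q2 i ^ forest_size (snd (p i))) *\<^sub>k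
                 (\<Prod>i\<in>{1..n}. basis (snd (p i))))))))"

end

theory Submission
  imports Defs "HOL-Library.Disjoint_Sets"
begin

text \<open>
  Write \<open>\<sigma>\<^sub>j(f\<^sub>1, \<dots>, f\<^sub>n)\<close> for \<open>f\<^sub>1 \<cdots> f\<^sub>n\<close> scaled by the product of the powers of \<open>q\<^bsub>ji\<^esub>\<close> with
  exponents \<open>|f\<^sub>i|\<close>. A tree is determined up to isomorphism by the multiset of the subtrees
  above the children of its root, each paired with the colour of the edge below it, so \<open>\<lambda>\<close> is a
  bijection from tuples of forests to trees. Hence \<open>\<Delta> \<circ> \<lambda> = (\<sigma>\<^sub>1 \<otimes> \<lambda> + \<lambda> \<otimes> \<sigma>\<^sub>2) \<circ> \<Delta>\<close> defines a unique
  multiplicative \<open>\<Delta>\<close> by recursion on the number of vertices.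
  Each \<open>\<sigma>\<^sub>j\<close> is a morphism of algebras and, as \<open>\<Delta>\<close> respects the grading, of coalgebras. Therefore both
  threefold coproducts of \<open>\<lambda>(f)\<close> are obtained by applying
  \<open>\<sigma>\<^sub>1 \<otimes> \<sigma>\<^sub>1 \<otimes> \<lambda> + \<sigma>\<^sub>1 \<otimes> \<lambda> \<otimes> \<sigma>\<^sub>2 + \<lambda> \<otimes> \<sigma>\<^sub>2 \<otimes> \<sigma>\<^sub>2\<close> to the threefold coproduct of \<open>f\<close>, and coassociativity
  follows by induction. The antipode comes from connectedness.
\<close>

text \<open>Since \<open>n\<close> is a variable, the tensor power in which the n Sweedler sums live
  has no fixed type expression. A tuple of forests is therefore stored as one multiset of pairs
  (colour, tree); the simultaneous sums become a single product of tagged coproducts, and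
  \<open>\<lambda>\<close> and \<open>\<sigma>\<^sub>j\<close> become maps out of one free module.
  The grading has to be settled before coassociativity. That \<open>\<sigma>\<^sub>j\<close>
  respects coproducts rests on \<open>q ^ (a + b) = q ^ a * q ^ b\<close>, applied to terms whose
  two weights add up to the weight of the tree; the convention \<open>q ^ 0 = 1\<close> keeps this
  true at \<open>q = 0\<close>. The counit reads off the coefficient of the empty forest. It is
  preserved by \<open>\<sigma>\<^sub>j\<close> and vanishes on the image of
  \<open>\<lambda>\<close>, so in each counit law one of the two summands disappears. Posets serve
  only to show that grafting is bijective and how it changes the number of vertices; the Hopf
  algebra argument uses nothing else about trees.\<close>

abbreviation keys where "keys \<equiv> Poly_Mapping.keys"
abbreviation lookup where "lookup \<equiv> Poly_Mapping.lookup"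
abbreviation linear where "linear \<equiv> linear_map_on UNIV"

section \<open>Linear maps between free modules\<close>

lemma lookup_smul [simp]: "lookup (c *\<^sub>k x) b = c * lookup x b"
  unfolding smul_def by (simp add: Poly_Mapping.map.rep_eq when_def in_keys_iff)

lemma smul_add: "c *\<^sub>k (x + y) = c *\<^sub>k x + c *\<^sub>k y"
  by (rule poly_mapping_eqI) (simp add: lookup_add algebra_simps)

lemma add_smul: "(c + d) *\<^sub>k x = c *\<^sub>k x + d *\<^sub>k x"
  by (rule poly_mapping_eqI) (simp add: lookup_add algebra_simps)

lemma smul_smul [simp]: "c *\<^sub>k (d *\<^sub>k x) = (c * d) *\<^sub>k x"
  by (rule poly_mapping_eqI) (simp add: algebra_simps)

lemma smul_one [simp]: "1 *\<^sub>k x = x"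
  by (rule poly_mapping_eqI) simp

lemma smul_zero [simp]: "0 *\<^sub>k x = 0" "c *\<^sub>k 0 = 0"
  by (rule poly_mapping_eqI, simp)+

lemma smul_sum: "c *\<^sub>k (\<Sum>i\<in>I. x i) = (\<Sum>i\<in>I. c *\<^sub>k x i)"
  by (rule poly_mapping_eqI) (simp add: lookup_sum sum_distrib_left)

lemma smul_mult: "(c *\<^sub>k x) * y = c *\<^sub>k (x * y)" for x y :: "'b::monoid_add \<Rightarrow>\<^sub>0 'k::comm_ring_1"
  unfolding smul_def by (simp add: mult_map_scale_conv_mult mult.assoc)

lemma mult_smul: "x * (c *\<^sub>k y) = c *\<^sub>k (x * y)"
  for x y :: "'b::comm_monoid_add \<Rightarrow>\<^sub>0 'k::comm_ring_1"
  using smul_mult[of c y x] by (simp add: mult.commute)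

lemma single_eq_smul: "Poly_Mapping.single b c = c *\<^sub>k basis b"
  by (rule poly_mapping_eqI) (simp add: basis_def lookup_single when_def)

lemma keys_basis [simp]: "keys (basis b :: 'b \<Rightarrow>\<^sub>0 'k::comm_ring_1) = {b}"
  by (simp add: basis_def)

lemma lookup_basis: "lookup (basis b) a = (1 when b = a)"
  by (simp add: basis_def lookup_single)

lemma basis_zero: "basis 0 = 1"
  by (simp add: basis_def)

lemma basis_add: "basis (a + b) = basis a * basis b"
  by (simp add: basis_def mult_single)

lemma basis_sum: "basis (\<Sum>i\<in>I. a i) = (\<Prod>i\<in>I. basis (a i))"
  by (induction I rule: infinite_finite_induct) (simp_all add: basis_zero basis_add)

lemma lin_ext_superset:
  assumes "finite A" "keys x \<subseteq> A"
  shows "lin_ext g x = (\<Sum>b\<in>A. lookup x b *\<^sub>k g b)"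
  unfolding lin_ext_def using assms
  by (intro sum.mono_neutral_left) (auto simp: in_keys_iff)

text \<open>Declared as a function congruence because \<open>left_inv\<close> calls itself under
  \<open>lin_ext\<close>.\<close>

lemma lin_ext_cong [fundef_cong]:
  assumes "x = y" "\<And>b. b \<in> keys y \<Longrightarrow> g b = h b"
  shows "lin_ext g x = lin_ext h y"
  using assms unfolding lin_ext_def by simp

lemma keys_smul: "keys (c *\<^sub>k x) \<subseteq> keys x"
  by (auto simp: in_keys_iff)

lemma linearI:
  assumes "\<And>x y. f (x + y) = f x + f y" "\<And>c x. f (c *\<^sub>k x) = c *\<^sub>k f x"
  shows "linear f"
  using assms by (simp add: linear_map_on_def)

lemma linear_add: "linear f \<Longrightarrow> f (x + y) = f x + f y"
  and linear_smul: "linear f \<Longrightarrow> f (c *\<^sub>k x) = c *\<^sub>k f x"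
  by (simp_all add: linear_map_on_def)

lemma linear_zero: "linear f \<Longrightarrow> f 0 = 0"
  using linear_smul[of f 0 0] by simp

lemma linear_sum: "linear f \<Longrightarrow> f (\<Sum>i\<in>I. x i) = (\<Sum>i\<in>I. f (x i))"
  by (induction I rule: infinite_finite_induct) (simp_all add: linear_zero linear_add)

lemma linear_lin_ext [simp]:
  fixes g :: "'b \<Rightarrow> ('c \<Rightarrow>\<^sub>0 'k::comm_ring_1)"
  shows "linear (lin_ext g)"
proof (rule linearI)
  fix x y :: "'b \<Rightarrow>\<^sub>0 'k"
  have "lin_ext g (x + y) = (\<Sum>b\<in>keys x \<union> keys y. lookup (x + y) b *\<^sub>k g b)"
    by (rule lin_ext_superset) (simp_all add: keys_add)
  then show "lin_ext g (x + y) = lin_ext g x + lin_ext g y"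
    by (simp add: lookup_add add_smul sum.distrib lin_ext_superset[of "keys x \<union> keys y"])
next
  fix c and x :: "'b \<Rightarrow>\<^sub>0 'k"
  show "lin_ext g (c *\<^sub>k x) = c *\<^sub>k lin_ext g x"
    by (simp add: lin_ext_superset[of "keys x"] keys_smul smul_sum)
qed

lemmas lin_ext_add = linear_add[OF linear_lin_ext]
lemmas lin_ext_smul = linear_smul[OF linear_lin_ext]
lemmas lin_ext_zero = linear_zero[OF linear_lin_ext]
lemmas lin_ext_sum = linear_sum[OF linear_lin_ext]

lemma lin_ext_basis [simp]: "lin_ext g (basis b) = g b"
  by (simp add: lin_ext_def basis_def)

lemma lin_ext_basis_id: "lin_ext basis x = x"
proof (rule poly_mapping_eqI)
  fix b
  have "lookup (lin_ext basis x) b = (\<Sum>a\<in>keys x. lookup x a * (1 when a = b))"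
    by (simp add: lin_ext_def lookup_sum lookup_basis)
  also have "\<dots> = lookup x b"
    by (simp add: when_def in_keys_iff if_distrib[of "(*) _"] cong: if_cong)
  finally show "lookup (lin_ext basis x) b = lookup x b" .
qed

lemma linear_lin_ext_commute: "linear f \<Longrightarrow> f (lin_ext g x) = lin_ext (\<lambda>b. f (g b)) x"
  by (simp add: lin_ext_def linear_sum linear_smul)

lemma linear_eq_lin_ext: "linear f \<Longrightarrow> f x = lin_ext (\<lambda>b. f (basis b)) x"
  using linear_lin_ext_commute[of f basis x] by (simp add: lin_ext_basis_id)

lemma linear_eqI:
  assumes "linear f" "linear g" "\<And>b. b \<in> keys x \<Longrightarrow> f (basis b) = g (basis b)"
  shows "f x = g x"
proof -
  have "lin_ext (\<lambda>b. f (basis b)) x = lin_ext (\<lambda>b. g (basis b)) x"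
    by (rule lin_ext_cong) (simp_all add: assms(3))
  then show ?thesis
    using linear_eq_lin_ext[OF assms(1), of x] linear_eq_lin_ext[OF assms(2), of x] by simp
qed

lemma lin_ext_zero_fun: "lin_ext (\<lambda>b. 0) x = 0"
  by (simp add: lin_ext_def)

lemma lin_ext_plus_fun: "lin_ext (\<lambda>b. g b + h b) x = lin_ext g x + lin_ext h x"
  by (simp add: lin_ext_def smul_add sum.distrib)

lemma lin_ext_lin_ext: "lin_ext g (lin_ext h x) = lin_ext (\<lambda>b. lin_ext g (h b)) x"
  by (simp add: linear_lin_ext_commute)

lemma lin_ext_smul_fun: "lin_ext (\<lambda>b. c *\<^sub>k g b) x = c *\<^sub>k lin_ext g x"
  by (simp add: lin_ext_def smul_sum mult_ac)

lemma lin_ext_commute: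
  "lin_ext (\<lambda>a. lin_ext (\<lambda>b. g a b) y) x = lin_ext (\<lambda>b. lin_ext (\<lambda>a. g a b) x) y"
  unfolding lin_ext_def smul_sum by (subst sum.swap) (simp add: mult_ac)

lemma lin_ext_times: "lin_ext g x * y = lin_ext (\<lambda>a. g a * y) x"
  for y :: "'b::comm_monoid_add \<Rightarrow>\<^sub>0 'k::comm_ring_1"
  by (simp add: lin_ext_def sum_distrib_right smul_mult)

lemma times_lin_ext: "y * lin_ext g x = lin_ext (\<lambda>a. y * g a) x"
  for y :: "'b::comm_monoid_add \<Rightarrow>\<^sub>0 'k::comm_ring_1"
  by (simp add: lin_ext_def sum_distrib_left mult_smul)

text \<open>A monoid morphism extends to a morphism of monoid algebras. Asking for multiplicativity
  on the supports only makes this available for maps that are multiplicative just on a submonoid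
  \<open>B\<close>.\<close>

lemma lin_ext_mult:
  fixes g :: "'b::comm_monoid_add \<Rightarrow> ('c::comm_monoid_add \<Rightarrow>\<^sub>0 'k::comm_ring_1)"
  assumes "\<And>a b. a \<in> keys x \<Longrightarrow> b \<in> keys y \<Longrightarrow> g (a + b) = g a * g b"
  shows "lin_ext g (x * y) = lin_ext g x * lin_ext g y"
proof -
  \<comment> \<open>Kept general in \<open>h\<close>: the instance \<open>h = basis\<close> expands
    \<open>x * y\<close> itself, the instance \<open>h = g\<close> the right-hand side.\<close>
  have prod: "lin_ext h x * lin_ext h y
      = (\<Sum>a\<in>keys x. \<Sum>b\<in>keys y. (lookup x a * lookup y b) *\<^sub>k (h a * h b))"
    for h :: "'b \<Rightarrow> ('d::comm_monoid_add \<Rightarrow>\<^sub>0 'k)"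
    by (simp only: lin_ext_def sum_product smul_mult mult_smul smul_smul mult.commute[of "lookup y _"])
  have "x * y = (\<Sum>a\<in>keys x. \<Sum>b\<in>keys y. (lookup x a * lookup y b) *\<^sub>k basis (a + b))"
    using prod[of basis] by (simp only: lin_ext_basis_id basis_add)
  then show ?thesis
    by (simp add: prod lin_ext_sum lin_ext_smul assms)
qed

lemma free_mod_add: "x \<in> free_mod B \<Longrightarrow> y \<in> free_mod B \<Longrightarrow> x + y \<in> free_mod B"
  using keys_add[of x y] by (auto simp: free_mod_def)

lemma free_mod_smul: "x \<in> free_mod B \<Longrightarrow> c *\<^sub>k x \<in> free_mod B"
  using keys_smul[of c x] by (auto simp: free_mod_def)

lemma free_mod_zero [simp]: "0 \<in> free_mod B"
  by (auto simp: free_mod_def)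

lemma free_mod_sum: "(\<And>i. i \<in> I \<Longrightarrow> x i \<in> free_mod B) \<Longrightarrow> (\<Sum>i\<in>I. x i) \<in> free_mod B"
  by (induction I rule: infinite_finite_induct) (simp_all add: free_mod_add)

lemma free_mod_basis [simp]: "basis b \<in> free_mod B \<longleftrightarrow> b \<in> B"
  for B :: "'b set"
  by (auto simp: free_mod_def)

lemma free_mod_one: "0 \<in> B \<Longrightarrow> 1 \<in> free_mod B"
  by (auto simp: free_mod_def)

lemma free_mod_mono: "x \<in> free_mod B \<Longrightarrow> B \<subseteq> C \<Longrightarrow> x \<in> free_mod C"
  by (auto simp: free_mod_def)

lemma free_mod_lin_ext:
  "(\<And>b. b \<in> keys x \<Longrightarrow> g b \<in> free_mod B) \<Longrightarrow> lin_ext g x \<in> free_mod B"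
  by (simp add: lin_ext_def free_mod_sum free_mod_smul)

lemma free_mod_mult:
  assumes "x \<in> free_mod B" "y \<in> free_mod C" "\<And>b c. b \<in> B \<Longrightarrow> c \<in> C \<Longrightarrow> b + c \<in> D"
  shows "x * y \<in> free_mod D"
  using assms keys_mult[of x y] by (fastforce simp: free_mod_def)

lemma keys_free_mod: "x \<in> free_mod B \<Longrightarrow> b \<in> keys x \<Longrightarrow> b \<in> B"
  by (auto simp: free_mod_def)

section \<open>Tensor products\<close>

lemma tensor_lin_ext: "x \<otimes> y = lin_ext (\<lambda>a. lin_ext (\<lambda>b. basis (a, b)) y) x"
  by (simp add: tensor_def lin_ext_def single_eq_smul smul_sum)

lemma tensor_basis [simp]: "basis a \<otimes> basis b = basis (a, b)"
  by (simp add: tensor_lin_ext)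

lemma linear_tensor_left: "linear (\<lambda>x. x \<otimes> y)"
  by (simp add: tensor_lin_ext)

lemma linear_tensor_right: "linear (\<lambda>y. x \<otimes> y)"
  by (rule linearI)
    (simp_all add: tensor_lin_ext lin_ext_add lin_ext_smul lin_ext_plus_fun,
      simp add: lin_ext_def smul_sum mult_ac)

lemmas tensor_add_left = linear_add[OF linear_tensor_left]
lemmas tensor_add_right = linear_add[OF linear_tensor_right]
lemmas tensor_smul_left = linear_smul[OF linear_tensor_left]
lemmas tensor_smul_right = linear_smul[OF linear_tensor_right]

lemma one_tensor_one: "1 \<otimes> 1 = 1"
  by (simp flip: basis_zero add: zero_prod_def)

lemma tensor_mult: "(x \<otimes> y) * (x' \<otimes> y') = (x * x') \<otimes> (y * y')"
  for x x' :: "'b::comm_monoid_add \<Rightarrow>\<^sub>0 'k::comm_ring_1"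
    and y y' :: "'c::comm_monoid_add \<Rightarrow>\<^sub>0 'k"
proof -
  note lin = tensor_add_left tensor_add_right tensor_smul_left tensor_smul_right
    distrib_left distrib_right smul_mult mult_smul
  \<comment> \<open>Both sides are linear in each of the four arguments. One argument per step is
    freed from being a basis element, in the order \<open>y'\<close>, \<open>x'\<close>,
    \<open>y\<close>, \<open>x\<close>.\<close>
  have 1: "(basis a \<otimes> basis b) * (basis a' \<otimes> y') = (basis a * basis a') \<otimes> (basis b * y')" for a a' :: 'b and b
    by (rule linear_eqI[where x = y'], (rule linearI; simp add: lin)+) (simp flip: basis_add)
  have 2: "(basis a \<otimes> basis b) * (x' \<otimes> y') = (basis a * x') \<otimes> (basis b * y')" for a b
    by (rule linear_eqI[where x = x'], (rule linearI; simp add: lin)+) (simp add: 1 del: tensor_basis)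
  have 3: "(basis a \<otimes> y) * (x' \<otimes> y') = (basis a * x') \<otimes> (y * y')" for a
    by (rule linear_eqI[where x = y], (rule linearI; simp add: lin)+) (simp add: 2 del: tensor_basis)
  show ?thesis
    by (rule linear_eqI[where x = x], (rule linearI; simp add: lin)+) (simp add: 3)
qed

lemma free_mod_tensor:
  assumes "x \<in> free_mod B" "y \<in> free_mod C" "\<And>b c. b \<in> B \<Longrightarrow> c \<in> C \<Longrightarrow> (b, c) \<in> D"
  shows "x \<otimes> y \<in> free_mod D"
  unfolding tensor_lin_ext
  using assms by (intro free_mod_lin_ext) (auto dest: keys_free_mod)

lemma lin_ext_tensor: "lin_ext g (x \<otimes> y) = lin_ext (\<lambda>a. lin_ext (\<lambda>b. g (a, b)) y) x"
  by (simp add: tensor_lin_ext linear_lin_ext_commute[OF linear_lin_ext])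

lemma tensor_lin_ext_left: "lin_ext g x \<otimes> y = lin_ext (\<lambda>a. g a \<otimes> y) x"
  by (rule linear_lin_ext_commute[OF linear_tensor_left])

lemma tensor_lin_ext_right: "x \<otimes> lin_ext g y = lin_ext (\<lambda>b. x \<otimes> g b) y"
  by (rule linear_lin_ext_commute[OF linear_tensor_right])

lemma mult_map_tensor: "mult_map (x \<otimes> y) = x * y"
proof -
  have "mult_map (x \<otimes> y) = lin_ext basis x * lin_ext basis y"
    by (simp add: mult_map_def lin_ext_tensor lin_ext_times times_lin_ext)
      (rule lin_ext_commute)
  then show ?thesis by (simp add: lin_ext_basis_id)
qed

lemma one_eq_basis_pair: "1 = basis (0, 0)"
  by (simp add: zero_prod_def flip: basis_zero)

section \<open>Graded connected bialgebras\<close>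

lemma homogeneous_iff: "x \<in> homogeneous B deg m \<longleftrightarrow> (\<forall>b\<in>keys x. b \<in> B \<and> deg b = m)"
  by (auto simp: homogeneous_def free_mod_def)

lemma homogeneous_uminus: "x \<in> homogeneous B deg m \<Longrightarrow> - x \<in> homogeneous B deg m"
  by (simp add: homogeneous_iff in_keys_iff)

text \<open>A bialgebra presented on a basis that is a commutative monoid under multiplication. The
  counit is implicit: it is the coefficient of the unit \<open>0\<close>.
  \<open>deg_eq_0_iff\<close> expresses connectedness, and \<open>D_closed\<close> bundles closure
  with the grading.\<close>

locale graded_bialgebra =
  fixes B :: "'b::comm_monoid_add set"
    and deg :: "'b \<Rightarrow> nat"
    and D :: "'b \<Rightarrow> (('b \<times> 'b) \<Rightarrow>\<^sub>0 'k::field)"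
  assumes zero_closed: "0 \<in> B"
    and add_closed: "a \<in> B \<Longrightarrow> b \<in> B \<Longrightarrow> a + b \<in> B"
    and deg_eq_0_iff: "b \<in> B \<Longrightarrow> deg b = 0 \<longleftrightarrow> b = 0"
    and deg_add: "a \<in> B \<Longrightarrow> b \<in> B \<Longrightarrow> deg (a + b) = deg a + deg b"
    and D_closed: "b \<in> B \<Longrightarrow> D b \<in> free_mod {(a, c). a \<in> B \<and> c \<in> B \<and> deg a + deg c = deg b}"
    and D_zero: "D 0 = 1"
    and D_add: "a \<in> B \<Longrightarrow> b \<in> B \<Longrightarrow> D (a + b) = D a * D b"
    and D_counit_left: "b \<in> B \<Longrightarrow> lin_ext (\<lambda>(a, c). if a = 0 then basis c else 0) (D b) = basis b"
    and D_counit_right: "b \<in> B \<Longrightarrow> lin_ext (\<lambda>(a, c). if c = 0 then basis a else 0) (D b) = basis b"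
    and D_coassoc: "b \<in> B \<Longrightarrow>
      lin_ext (\<lambda>(a, c). lin_ext (\<lambda>(a', a''). basis (a', a'', c)) (D a)) (D b) =
      lin_ext (\<lambda>(a, c). lin_ext (\<lambda>(c', c''). basis (a, c', c'')) (D c)) (D b)"
begin

lemma keys_D: "(a, c) \<in> keys (D b) \<Longrightarrow> b \<in> B \<Longrightarrow> a \<in> B \<and> c \<in> B \<and> deg a + deg c = deg b"
  using keys_free_mod[OF D_closed] by blast

section \<open>Convolution and the antipode\<close>

definition conv :: "('b \<Rightarrow> ('b \<Rightarrow>\<^sub>0 'k)) \<Rightarrow> ('b \<Rightarrow> ('b \<Rightarrow>\<^sub>0 'k)) \<Rightarrow> 'b \<Rightarrow> ('b \<Rightarrow>\<^sub>0 'k)" where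
  "conv f g b = lin_ext (\<lambda>(a, c). f a * g c) (D b)"

definition conv_unit :: "'b \<Rightarrow> ('b \<Rightarrow>\<^sub>0 'k)" where
  "conv_unit b = (if b = 0 then 1 else 0)"

lemma conv_cong:
  assumes "b \<in> B" "\<And>a. a \<in> B \<Longrightarrow> f a = f' a" "\<And>a. a \<in> B \<Longrightarrow> g a = g' a"
  shows "conv f g b = conv f' g' b"
  unfolding conv_def using assms keys_D by (intro lin_ext_cong) auto

text \<open>Both sides are the image of a threefold coproduct under the map multiplying the values
  of \<open>f\<close>, \<open>g\<close> and \<open>h\<close>, so coassociativity identifies
  them.\<close>

lemma conv_assoc:
  assumes "b \<in> B"
  shows "conv (conv f g) h b = conv f (conv g h) b"
proof -
  let ?K = "\<lambda>(x, y, z). f x * g y * h z"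
  have "conv (conv f g) h b =
      lin_ext ?K (lin_ext (\<lambda>(a, c). lin_ext (\<lambda>(a', a''). basis (a', a'', c)) (D a)) (D b))"
    by (simp add: conv_def lin_ext_lin_ext lin_ext_times case_prod_unfold)
  also have "\<dots> = conv f (conv g h) b"
    unfolding D_coassoc[OF assms]
    by (simp add: conv_def lin_ext_lin_ext times_lin_ext case_prod_unfold mult.assoc)
  finally show ?thesis .
qed

lemma conv_unit_left:
  assumes "b \<in> B"
  shows "conv conv_unit g b = g b"
proof -
  have "conv conv_unit g b = lin_ext g (lin_ext (\<lambda>(a, c). if a = 0 then basis c else 0) (D b))"
    unfolding conv_def lin_ext_lin_ext
    by (intro lin_ext_cong) (auto simp: conv_unit_def lin_ext_zero)
  then show ?thesis using D_counit_left[OF assms] by simp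
qed

lemma conv_unit_right:
  assumes "b \<in> B"
  shows "conv g conv_unit b = g b"
proof -
  have "conv g conv_unit b = lin_ext g (lin_ext (\<lambda>(a, c). if c = 0 then basis a else 0) (D b))"
    unfolding conv_def lin_ext_lin_ext
    by (intro lin_ext_cong) (auto simp: conv_unit_def lin_ext_zero)
  then show ?thesis using D_counit_right[OF assms] by simp
qed

text \<open>Solves \<open>conv (left_inv f) f b = 0\<close> for the contribution of the term with
  right factor \<open>0\<close>. The guard removes exactly such terms when \<open>b\<close> lies in
  \<open>B\<close>, and it makes the recursion terminate without any knowledge of the support of
  \<open>D b\<close>.\<close>

function left_inv :: "('b \<Rightarrow> ('b \<Rightarrow>\<^sub>0 'k)) \<Rightarrow> 'b \<Rightarrow> ('b \<Rightarrow>\<^sub>0 'k)" where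
  "left_inv f b = (if b = 0 then 1 else
     - lin_ext (\<lambda>(a, c). if deg a < deg b then left_inv f a * f c else 0) (D b))"
  by pat_completeness auto
termination by (relation "measure (\<lambda>(f, b). deg b)") auto

declare left_inv.simps [simp del]

text \<open>The terms with \<open>c = 0\<close> add up to \<open>left_inv f b\<close> by the right
  counit law and \<open>f 0 = 1\<close>; the remaining ones are its negative by the
  recursion.\<close>

lemma conv_left_inv:
  assumes b: "b \<in> B" and f: "f 0 = 1"
  shows "conv (left_inv f) f b = conv_unit b"
proof (cases "b = 0")
  case True
  then show ?thesis
    by (simp add: conv_def D_zero flip: basis_zero)
      (simp add: zero_prod_def f left_inv.simps[of f 0] conv_unit_def basis_zero)
next
  case False
  have "conv (left_inv f) f b =
      lin_ext (\<lambda>(a, c). if deg a < deg b then left_inv f a * f c else 0) (D b) +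
      lin_ext (left_inv f) (lin_ext (\<lambda>(a, c). if c = 0 then basis a else 0) (D b))"
    unfolding lin_ext_lin_ext lin_ext_plus_fun[symmetric] conv_def
  proof (rule lin_ext_cong, rule refl)
    fix p assume p: "p \<in> keys (D b)"
    obtain a c where [simp]: "p = (a, c)" by force
    have *: "a \<in> B" "c \<in> B" "deg a + deg c = deg b"
      using keys_D[of a c b] p b by auto
    \<comment> \<open>Degrees add up to \<open>deg b\<close>, so the left degree fails to drop
      exactly when \<open>c\<close> has degree 0, which by connectedness means
      \<open>c = 0\<close>.\<close>
    then have "c = 0 \<longleftrightarrow> \<not> deg a < deg b"
      using deg_eq_0_iff[of c] by auto
    then show "(case p of (a, c) \<Rightarrow> left_inv f a * f c) =
        (case p of (a, c) \<Rightarrow> if deg a < deg b then left_inv f a * f c else 0) +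
        lin_ext (left_inv f) (case p of (a, c) \<Rightarrow> if c = 0 then basis a else 0)"
      by (cases "c = 0") (simp_all add: lin_ext_zero f)
  qed
  then show ?thesis
    unfolding D_counit_right[OF b] using False by (simp add: left_inv.simps[of f b] conv_unit_def)
qed

lemma homogeneous_mult:
  fixes x y :: "'b \<Rightarrow>\<^sub>0 'k"
  assumes "x \<in> homogeneous B deg i" "y \<in> homogeneous B deg j"
  shows "x * y \<in> homogeneous B deg (i + j)"
  using assms unfolding homogeneous_def
  by (rule free_mod_mult) (auto simp: add_closed deg_add)

lemma homogeneous_one: "(1 :: 'b \<Rightarrow>\<^sub>0 'k) \<in> homogeneous B deg 0"
  using zero_closed deg_eq_0_iff[of 0] by (simp add: homogeneous_iff)

lemma homogeneous_left_inv:
  assumes f: "\<And>b. b \<in> B \<Longrightarrow> f b \<in> homogeneous B deg (deg b)"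
  shows "b \<in> B \<Longrightarrow> left_inv f b \<in> homogeneous B deg (deg b)"
proof (induction "deg b" arbitrary: b rule: less_induct)
  case less
  have "lin_ext (\<lambda>(a, c). if deg a < deg b then left_inv f a * f c else 0) (D b)
      \<in> homogeneous B deg (deg b)"
    unfolding homogeneous_def
  proof (rule free_mod_lin_ext)
    fix p assume p: "p \<in> keys (D b)"
    obtain a c where [simp]: "p = (a, c)" by force
    have *: "a \<in> B" "c \<in> B" "deg a + deg c = deg b"
      using keys_D[of a c b] p less.prems by auto
    show "(case p of (a, c) \<Rightarrow> if deg a < deg b then left_inv f a * f c else 0)
        \<in> free_mod {x \<in> B. deg x = deg b}"
      using homogeneous_mult[OF less.hyps[of a] f[of c]] * by (auto simp: homogeneous_def)
  qed
  then have "- lin_ext (\<lambda>(a, c). if deg a < deg b then left_inv f a * f c else 0) (D b)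
      \<in> homogeneous B deg (deg b)"
    by (rule homogeneous_uminus)
  then show ?case
    using homogeneous_one zero_closed deg_eq_0_iff[of 0]
    by (subst left_inv.simps) simp
qed

definition antipode :: "'b \<Rightarrow> ('b \<Rightarrow>\<^sub>0 'k)" where
  "antipode = left_inv basis"

lemma homogeneous_antipode: "b \<in> B \<Longrightarrow> antipode b \<in> homogeneous B deg (deg b)"
  unfolding antipode_def by (rule homogeneous_left_inv) (auto simp: homogeneous_def)

lemma conv_antipode_left: "b \<in> B \<Longrightarrow> conv antipode basis b = conv_unit b"
  unfolding antipode_def by (rule conv_left_inv) (auto simp: basis_zero)

text \<open>The antipode has a left inverse of its own, which must therefore be the identity.\<close>

lemma conv_antipode_right:
  assumes "b \<in> B"
  shows "conv basis antipode b = conv_unit b"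
proof -
  define S' where "S' = left_inv antipode"
  have S': "conv S' antipode b = conv_unit b" if "b \<in> B" for b
    unfolding S'_def by (rule conv_left_inv[OF that]) (simp add: antipode_def left_inv.simps[of _ 0])
  have "S' b = basis b" if b: "b \<in> B" for b
  proof -
    have "S' b = conv S' conv_unit b"
      by (rule conv_unit_right[OF b, symmetric])
    also have "\<dots> = conv S' (conv antipode basis) b"
      by (rule conv_cong[OF b]) (simp_all add: conv_antipode_left)
    also have "\<dots> = conv (conv S' antipode) basis b"
      by (rule conv_assoc[OF b, symmetric])
    also have "\<dots> = conv conv_unit basis b"
      by (rule conv_cong[OF b]) (simp_all add: S')
    also have "\<dots> = basis b"
      by (rule conv_unit_left[OF b])
    finally show ?thesis .
  qed
  then show ?thesis
    using S'[OF assms] conv_cong[OF assms, of S' basis antipode antipode] by simp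
qed

text \<open>Writes the counit followed by the unit as a linear extension, so that its
  multiplicativity and the antipode laws can be checked on basis elements.\<close>

lemma lookup_zero_eq_lin_ext: "lookup x 0 *\<^sub>k 1 = lin_ext conv_unit x"
  by (simp add: lin_ext_def conv_unit_def if_distrib[of "(*\<^sub>k) _"] in_keys_iff cong: if_cong)

lemma counit_mult:
  fixes x y :: "'b \<Rightarrow>\<^sub>0 'k"
  assumes "x \<in> free_mod B" "y \<in> free_mod B"
  shows "lookup (x * y) 0 = lookup x 0 * lookup y 0"
proof -
  have "lin_ext conv_unit (x * y) = lin_ext conv_unit x * lin_ext conv_unit y"
  proof (rule lin_ext_mult)
    \<comment> \<open>In a connected grading a product of basis elements is the unit only if both
      factors are, because degrees add and only the unit has degree 0.\<close>
    fix a b assume "a \<in> keys x" "b \<in> keys y"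
    then have "a \<in> B" "b \<in> B" using assms by (auto dest: keys_free_mod)
    then have "a + b = 0 \<longleftrightarrow> a = 0 \<and> b = 0"
      using deg_eq_0_iff[of a] deg_eq_0_iff[of b] deg_eq_0_iff[of "a + b"]
      by (auto simp: add_closed deg_add)
    then show "conv_unit (a + b) = conv_unit a * conv_unit b" by (simp add: conv_unit_def)
  qed
  from arg_cong[OF this, of "\<lambda>z. lookup z 0"] show ?thesis
    by (simp add: smul_mult flip: lookup_zero_eq_lin_ext)
qed

theorem graded_connected_hopf_algebra:
  "graded_connected_hopf_algebra B deg (lin_ext D) (\<lambda>x. lookup x 0) (lin_ext antipode)"
proof
  show "(1 :: 'b \<Rightarrow>\<^sub>0 'k) \<in> free_mod B" by (simp add: free_mod_one zero_closed)
  show "x * y \<in> free_mod B" if "x \<in> free_mod B" "y \<in> free_mod B" for x y :: "'b \<Rightarrow>\<^sub>0 'k"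
    using that by (rule free_mod_mult) (rule add_closed)
  show "lin_ext D x \<in> free_mod (B \<times> B)" if "x \<in> free_mod B" for x
    by (rule free_mod_lin_ext, rule free_mod_mono[OF D_closed]) (use that in \<open>auto dest: keys_free_mod\<close>)
  show "linear_map_on (free_mod B) (lin_ext D)"
    by (simp add: linear_map_on_def lin_ext_add lin_ext_smul)
  have "lin_ext D (x * y) = lin_ext D x * lin_ext D y" if "x \<in> free_mod B" "y \<in> free_mod B" for x y
    by (rule lin_ext_mult, rule D_add) (use that in \<open>auto dest: keys_free_mod\<close>)
  moreover have "lin_ext D 1 = 1"
    by (simp flip: basis_zero) (simp add: D_zero basis_zero)
  ultimately show "multiplicative_on (free_mod B) (lin_ext D)"
    by (simp add: multiplicative_on_def)
  show "linear_form_on (free_mod B) (\<lambda>x :: 'b \<Rightarrow>\<^sub>0 'k. lookup x 0)"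
    by (simp add: linear_form_on_def lookup_add)
  show "multiplicative_on (free_mod B) (\<lambda>x :: 'b \<Rightarrow>\<^sub>0 'k. lookup x 0)"
    by (simp add: multiplicative_on_def counit_mult)
  show "tensor_assoc (tensor_map (lin_ext D) id (lin_ext D x)) = tensor_map id (lin_ext D) (lin_ext D x)"
    if x: "x \<in> free_mod B" for x
  proof -
    \<comment> \<open>Both composites are unfolded to the nested extensions in which
      \<open>D_coassoc\<close> is phrased.\<close>
    have l: "tensor_assoc (tensor_map (lin_ext D) id y) =
        lin_ext (\<lambda>(a, c). lin_ext (\<lambda>(a', a''). basis (a', a'', c)) (D a)) y" for y
      by (simp add: tensor_assoc_def tensor_map_def lin_ext_lin_ext lin_ext_tensor case_prod_unfold)
    have r: "tensor_map id (lin_ext D) y =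
        lin_ext (\<lambda>(a, c). lin_ext (\<lambda>(c', c''). basis (a, c', c'')) (D c)) y" for y
      by (simp add: tensor_map_def tensor_lin_ext case_prod_unfold)
    show ?thesis
      unfolding l r lin_ext_lin_ext
      by (rule lin_ext_cong, rule refl, rule D_coassoc) (rule keys_free_mod[OF x])
  qed
  show "counit_left (\<lambda>x. lookup x 0) (lin_ext D x) = x" if x: "x \<in> free_mod B" for x
  proof -
    have "counit_left (\<lambda>x. lookup x 0) (lin_ext D x) = lin_ext basis x"
      unfolding counit_left_def lin_ext_lin_ext
    proof (rule lin_ext_cong[OF refl])
      fix b assume "b \<in> keys x"
      then have "b \<in> B" by (rule keys_free_mod[OF x])
      have "lin_ext (\<lambda>(a, b). lookup (basis a) 0 *\<^sub>k basis b) (D b) =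
          lin_ext (\<lambda>(a, c). if a = 0 then basis c else 0) (D b)"
        by (rule lin_ext_cong) (auto simp: lookup_basis)
      then show "lin_ext (\<lambda>(a, b). lookup (basis a) 0 *\<^sub>k basis b) (D b) = basis b"
        using D_counit_left[OF \<open>b \<in> B\<close>] by simp
    qed
    then show ?thesis by (simp add: lin_ext_basis_id)
  qed
  show "counit_right (\<lambda>x. lookup x 0) (lin_ext D x) = x" if x: "x \<in> free_mod B" for x
  proof -
    have "counit_right (\<lambda>x. lookup x 0) (lin_ext D x) = lin_ext basis x"
      unfolding counit_right_def lin_ext_lin_ext
    proof (rule lin_ext_cong[OF refl])
      fix b assume "b \<in> keys x"
      then have "b \<in> B" by (rule keys_free_mod[OF x])
      have "lin_ext (\<lambda>(a, b). lookup (basis b) 0 *\<^sub>k basis a) (D b) =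
          lin_ext (\<lambda>(a, c). if c = 0 then basis a else 0) (D b)"
        by (rule lin_ext_cong) (auto simp: lookup_basis)
      then show "lin_ext (\<lambda>(a, b). lookup (basis b) 0 *\<^sub>k basis a) (D b) = basis b"
        using D_counit_right[OF \<open>b \<in> B\<close>] by simp
    qed
    then show ?thesis by (simp add: lin_ext_basis_id)
  qed
  show "lin_ext antipode x \<in> free_mod B" if "x \<in> free_mod B" for x
  proof (rule free_mod_lin_ext)
    fix b assume "b \<in> keys x"
    then show "antipode b \<in> free_mod B"
      using homogeneous_antipode[OF keys_free_mod[OF that]] by (auto simp: homogeneous_def free_mod_def)
  qed
  show "linear_map_on (free_mod B) (lin_ext antipode)"
    by (simp add: linear_map_on_def lin_ext_add lin_ext_smul)
  show "mult_map (tensor_map (lin_ext antipode) id (lin_ext D x)) = lookup x 0 *\<^sub>k 1"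
    if x: "x \<in> free_mod B" for x
  proof -
    have "mult_map (tensor_map (lin_ext antipode) id (lin_ext D x)) = lin_ext (conv antipode basis) x"
      unfolding tensor_map_def conv_def
      by (subst linear_lin_ext_commute, simp add: mult_map_def)
         (simp add: lin_ext_lin_ext mult_map_tensor case_prod_unfold)
    also have "\<dots> = lookup x 0 *\<^sub>k 1"
      unfolding lookup_zero_eq_lin_ext
      by (rule lin_ext_cong, rule refl, rule conv_antipode_left) (rule keys_free_mod[OF x])
    finally show ?thesis .
  qed
  show "mult_map (tensor_map id (lin_ext antipode) (lin_ext D x)) = lookup x 0 *\<^sub>k 1"
    if x: "x \<in> free_mod B" for x
  proof -
    have "mult_map (tensor_map id (lin_ext antipode) (lin_ext D x)) = lin_ext (conv basis antipode) x"
      unfolding tensor_map_def conv_def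
      by (subst linear_lin_ext_commute, simp add: mult_map_def)
         (simp add: lin_ext_lin_ext mult_map_tensor case_prod_unfold)
    also have "\<dots> = lookup x 0 *\<^sub>k 1"
      unfolding lookup_zero_eq_lin_ext
      by (rule lin_ext_cong, rule refl, rule conv_antipode_right) (rule keys_free_mod[OF x])
    finally show ?thesis .
  qed
  show "(1 :: 'b \<Rightarrow>\<^sub>0 'k) \<in> homogeneous B deg 0" by (rule homogeneous_one)
  show "x * y \<in> homogeneous B deg (i + j)"
    if "x \<in> homogeneous B deg i" "y \<in> homogeneous B deg j" for x y :: "'b \<Rightarrow>\<^sub>0 'k" and i j
    using that by (rule homogeneous_mult)
  show "lin_ext D x \<in> homogeneous (B \<times> B) (\<lambda>(a, b). deg a + deg b) m"
    if x: "x \<in> homogeneous B deg m" for x m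
    unfolding homogeneous_def
    by (rule free_mod_lin_ext, rule free_mod_mono[OF D_closed]) (use x in \<open>auto simp: homogeneous_iff\<close>)
  show "lookup x 0 = 0" if "x \<in> homogeneous B deg m" "m > 0" for x :: "'b \<Rightarrow>\<^sub>0 'k" and m
    using that deg_eq_0_iff[OF zero_closed] unfolding homogeneous_iff by (metis in_keys_iff less_irrefl)
  show "lin_ext antipode x \<in> homogeneous B deg m" if x: "x \<in> homogeneous B deg m" for x m
  proof -
    have "antipode b \<in> homogeneous B deg m" if "b \<in> keys x" for b
      using homogeneous_antipode[of b] x that by (auto simp: homogeneous_iff)
    then show ?thesis unfolding homogeneous_def by (rule free_mod_lin_ext)
  qed
  show "(homogeneous B deg 0 :: ('b \<Rightarrow>\<^sub>0 'k) set) = {c *\<^sub>k 1 | c. True}"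
  proof (intro set_eqI iffI)
    fix x :: "'b \<Rightarrow>\<^sub>0 'k" assume x: "x \<in> homogeneous B deg 0"
    have "x = lookup x 0 *\<^sub>k 1"
    proof (rule poly_mapping_eqI)
      fix b show "lookup x b = lookup (lookup x 0 *\<^sub>k 1) b"
        using x deg_eq_0_iff[of b] by (cases "b \<in> keys x") (auto simp: homogeneous_iff in_keys_iff lookup_one when_def)
    qed
    then show "x \<in> {c *\<^sub>k 1 | c. True}" by blast
  next
    fix x :: "'b \<Rightarrow>\<^sub>0 'k" assume "x \<in> {c *\<^sub>k 1 | c. True}"
    then show "x \<in> homogeneous B deg 0"
      using homogeneous_one by (auto simp: homogeneous_def intro: free_mod_smul)
  qed
qed

end

section \<open>The coproduct on coloured trees\<close>

text \<open>This is \<open>D \<otimes> id\<close> followed by reassociation, with its argument left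
  free instead of fixed to a coproduct. For multiplicative \<open>D\<close> it is multiplicative in
  that argument, so coassociativity spreads from trees to forests and tuples.\<close>

definition coassoc_left ::
    "('b \<Rightarrow> (('b \<times> 'b) \<Rightarrow>\<^sub>0 'k::comm_ring_1)) \<Rightarrow> (('b \<times> 'b) \<Rightarrow>\<^sub>0 'k) \<Rightarrow> (('b \<times> 'b \<times> 'b) \<Rightarrow>\<^sub>0 'k)" where
  "coassoc_left D = lin_ext (\<lambda>(a, c). tensor_assoc (D a \<otimes> basis c))"

definition coassoc_right ::
    "('b \<Rightarrow> (('b \<times> 'b) \<Rightarrow>\<^sub>0 'k::comm_ring_1)) \<Rightarrow> (('b \<times> 'b) \<Rightarrow>\<^sub>0 'k) \<Rightarrow> (('b \<times> 'b \<times> 'b) \<Rightarrow>\<^sub>0 'k)" where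
  "coassoc_right D = lin_ext (\<lambda>(a, c). basis a \<otimes> D c)"

definition eps_left :: "(('b::zero \<times> 'b) \<Rightarrow>\<^sub>0 'k::comm_ring_1) \<Rightarrow> ('b \<Rightarrow>\<^sub>0 'k)" where
  "eps_left = lin_ext (\<lambda>(a, c). if a = 0 then basis c else 0)"

definition eps_right :: "(('b::zero \<times> 'b) \<Rightarrow>\<^sub>0 'k::comm_ring_1) \<Rightarrow> ('b \<Rightarrow>\<^sub>0 'k)" where
  "eps_right = lin_ext (\<lambda>(a, c). if c = 0 then basis a else 0)"

lemma linear_tensor_assoc: "linear tensor_assoc"
  by (simp add: tensor_assoc_def)

lemma tensor_assoc_tensor: "tensor_assoc ((x \<otimes> y) \<otimes> z) = x \<otimes> (y \<otimes> z)"
  by (simp only: tensor_assoc_def lin_ext_tensor prod.case tensor_lin_ext[of x "y \<otimes> z"])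

lemma tensor_assoc_mult: "tensor_assoc (x * y) = tensor_assoc x * tensor_assoc y"
  for x y :: "(('a::comm_monoid_add \<times> 'b::comm_monoid_add) \<times> 'c::comm_monoid_add) \<Rightarrow>\<^sub>0 'k::comm_ring_1"
  unfolding tensor_assoc_def
  by (rule lin_ext_mult) (auto simp flip: basis_add)

lemma coassoc_left_tensor: "coassoc_left D (x \<otimes> y) = tensor_assoc (lin_ext D x \<otimes> y)"
proof -
  have "coassoc_left D (x \<otimes> y) = tensor_assoc (lin_ext (\<lambda>a. D a \<otimes> lin_ext basis y) x)"
    by (simp add: coassoc_left_def lin_ext_tensor linear_lin_ext_commute[OF linear_tensor_assoc]
        tensor_lin_ext_right)
  then show ?thesis by (simp add: lin_ext_basis_id tensor_lin_ext_left)
qed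

lemma coassoc_right_tensor: "coassoc_right D (x \<otimes> y) = x \<otimes> lin_ext D y"
proof -
  have "coassoc_right D (x \<otimes> y) = lin_ext (\<lambda>a. basis a \<otimes> lin_ext D y) x"
    by (simp add: coassoc_right_def lin_ext_tensor tensor_lin_ext_right)
  also have "\<dots> = lin_ext basis x \<otimes> lin_ext D y"
    by (rule tensor_lin_ext_left[symmetric])
  finally show ?thesis by (simp add: lin_ext_basis_id)
qed

lemma coassoc_left_mult:
  fixes D :: "'b::comm_monoid_add \<Rightarrow> (('b \<times> 'b) \<Rightarrow>\<^sub>0 'k::comm_ring_1)"
  assumes "\<And>a b. D (a + b) = D a * D b"
  shows "coassoc_left D (x * y) = coassoc_left D x * coassoc_left D y"
  unfolding coassoc_left_def
  by (rule lin_ext_mult) (auto simp: assms basis_add tensor_mult tensor_assoc_mult simp flip: tensor_mult)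

lemma coassoc_right_mult:
  fixes D :: "'b::comm_monoid_add \<Rightarrow> (('b \<times> 'b) \<Rightarrow>\<^sub>0 'k::comm_ring_1)"
  assumes "\<And>a b. D (a + b) = D a * D b"
  shows "coassoc_right D (x * y) = coassoc_right D x * coassoc_right D y"
  unfolding coassoc_right_def
  by (rule lin_ext_mult) (auto simp: assms basis_add tensor_mult)

lemma coassoc_one:
  assumes "D 0 = 1"
  shows "coassoc_left D 1 = 1" "coassoc_right D 1 = 1"
  by (simp_all add: coassoc_left_def coassoc_right_def one_eq_basis_pair assms tensor_assoc_def
      zero_prod_def)

lemma eps_left_tensor: "eps_left (x \<otimes> y) = lookup x 0 *\<^sub>k y"
proof -
  have "eps_left (x \<otimes> y) = lin_ext (\<lambda>a. if a = 0 then y else 0) x"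
    unfolding eps_left_def lin_ext_tensor
    by (intro lin_ext_cong) (simp_all add: lin_ext_basis_id lin_ext_zero_fun)
  also have "\<dots> = lookup x 0 *\<^sub>k y"
    by (simp add: lin_ext_def if_distrib[of "(*\<^sub>k) _"] in_keys_iff cong: if_cong)
  finally show ?thesis .
qed

lemma eps_right_tensor: "eps_right (x \<otimes> y) = lookup y 0 *\<^sub>k x"
proof -
  have "eps_right (x \<otimes> y) = lin_ext (\<lambda>a. lookup y 0 *\<^sub>k basis a) x"
    unfolding eps_right_def lin_ext_tensor
    by (intro lin_ext_cong)
      (auto simp: lin_ext_def if_distrib[of "(*\<^sub>k) _"] in_keys_iff cong: if_cong)
  then show ?thesis by (simp add: lin_ext_smul_fun lin_ext_basis_id)
qed

text \<open>Stated for multisets, where a sum is empty only if both summands are; this makes the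
  counit multiplicative.\<close>

lemma eps_mult:
  fixes x y :: "('a multiset \<times> 'a multiset) \<Rightarrow>\<^sub>0 'k::comm_ring_1"
  shows "eps_left (x * y) = eps_left x * eps_left y" "eps_right (x * y) = eps_right x * eps_right y"
  unfolding eps_left_def eps_right_def
  by (rule lin_ext_mult, auto simp: basis_add)+

lemma eps_one:
  "eps_left (1 :: ('a multiset \<times> 'a multiset) \<Rightarrow>\<^sub>0 'k::comm_ring_1) = 1"
  "eps_right (1 :: ('a multiset \<times> 'a multiset) \<Rightarrow>\<^sub>0 'k::comm_ring_1) = 1"
  by (simp_all add: eps_left_def eps_right_def one_eq_basis_pair) (simp_all add: basis_def)

text \<open>
  The tensor power \<open>H\<^sup>\<otimes>\<^sup>n\<close> of the symmetric algebra \<open>H\<close> on a set of trees is identified with the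
  symmetric algebra on pairs of a colour and a tree: a tuple of forests becomes the
  multiset of all their trees, tagged by their positions. The \<open>i\<close>-th inclusion of \<open>H \<otimes> H\<close>
  into the tensor square of \<open>H\<^sup>\<otimes>\<^sup>n\<close> is \<open>tag i\<close>.
\<close>

definition tag :: "'c \<Rightarrow> ('a multiset \<times> 'a multiset \<Rightarrow>\<^sub>0 'k)
    \<Rightarrow> (('c \<times> 'a) multiset \<times> ('c \<times> 'a) multiset \<Rightarrow>\<^sub>0 'k::comm_ring_1)" where
  "tag i = lin_ext (\<lambda>(a, b). basis (image_mset (Pair i) a, image_mset (Pair i) b))"

lemma tag_mult: "tag i (x * y) = tag i x * tag i y"
  unfolding tag_def by (rule lin_ext_mult) (auto simp flip: basis_add)

lemma tag_one: "tag i 1 = 1"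
  by (simp add: tag_def one_eq_basis_pair)

text \<open>The interface between combinatorics and algebra: \<open>B\<close> grafts a tuple of
  forests, encoded as a tagged multiset, onto a new root, and the \<open>Suc\<close> counts that
  root.\<close>

locale coloured_trees =
  fixes I :: "'c set" and T :: "'a set"
    and B :: "('c \<times> 'a) multiset \<Rightarrow> 'a"
    and wt :: "'a \<Rightarrow> nat"
    and q1 q2 :: "'c \<Rightarrow> 'k::field"
  assumes B_bij: "bij_betw B {M. set_mset M \<subseteq> I \<times> T} T"
    and wt_B: "set_mset M \<subseteq> I \<times> T \<Longrightarrow> wt (B M) = Suc (\<Sum>(i, t)\<in>#M. wt t)"
begin

abbreviation weight :: "'a multiset \<Rightarrow> nat" where
  "weight F \<equiv> (\<Sum>t\<in>#F. wt t)"

abbreviation tuple_weight :: "('c \<times> 'a) multiset \<Rightarrow> nat" where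
  "tuple_weight M \<equiv> (\<Sum>(i, t)\<in>#M. wt t)"

definition dec :: "'a \<Rightarrow> ('c \<times> 'a) multiset" where
  "dec = the_inv_into {M. set_mset M \<subseteq> I \<times> T} B"

lemma dec_B: "set_mset M \<subseteq> I \<times> T \<Longrightarrow> dec (B M) = M"
  unfolding dec_def using B_bij by (intro the_inv_into_f_f) (auto simp: bij_betw_def)

lemma B_in_T: "set_mset M \<subseteq> I \<times> T \<Longrightarrow> B M \<in> T"
  using B_bij by (auto simp: bij_betw_def)

lemma tree_cases:
  assumes "t \<in> T"
  obtains M where "set_mset M \<subseteq> I \<times> T" "t = B M"
  using assms B_bij by (auto simp: bij_betw_def)

text \<open>The strict decrease drives the termination of the coproduct recursion and every
  induction on weight.\<close>

lemma wt_child: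
  assumes "set_mset M \<subseteq> I \<times> T" "(i, t) \<in># M"
  shows "i \<in> I" "t \<in> T" "wt t < wt (B M)"
proof -
  obtain N where "M = add_mset (i, t) N"
    using assms(2) by (meson mset_add)
  then show "i \<in> I" "t \<in> T" "wt t < wt (B M)" using assms(1) by (simp_all add: wt_B)
qed

lemma weight_eq_0_iff:
  assumes "set_mset F \<subseteq> T"
  shows "weight F = 0 \<longleftrightarrow> F = {#}"
proof -
  have "wt t \<noteq> 0" if "t \<in> T" for t
    using that by (rule tree_cases) (simp add: wt_B)
  then show ?thesis using assms by (cases F) auto
qed

text \<open>In the tagged encoding, \<open>twist q1\<close> and \<open>twist q2\<close> are
  \<open>\<sigma>\<^sub>1\<close> and \<open>\<sigma>\<^sub>2\<close>, \<open>join\<close> is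
  \<open>\<lambda>\<close>, and \<open>cocycle\<close> is \<open>\<sigma>\<^sub>1 \<otimes>
  \<lambda> + \<lambda> \<otimes> \<sigma>\<^sub>2\<close>. The last name reflects that the required
  formula makes \<open>\<lambda>\<close> a coderivation along the two twists, that is, a
  1-cocycle.\<close>

definition twist :: "('c \<Rightarrow> 'k) \<Rightarrow> ('c \<times> 'a) multiset \<Rightarrow> ('a multiset \<Rightarrow>\<^sub>0 'k)" where
  "twist q M = (\<Prod>(i, t)\<in>#M. q i ^ wt t) *\<^sub>k basis (image_mset snd M)"

definition join :: "('c \<times> 'a) multiset \<Rightarrow> ('a multiset \<Rightarrow>\<^sub>0 'k)" where
  "join M = basis {#B M#}"

definition cocycle :: "('c \<times> 'a) multiset \<times> ('c \<times> 'a) multiset \<Rightarrow> ('a multiset \<times> 'a multiset \<Rightarrow>\<^sub>0 'k)" where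
  "cocycle = (\<lambda>(a, b). twist q1 a \<otimes> join b + join a \<otimes> twist q2 b)"

text \<open>Outside \<open>T\<close> the value of \<open>dec\<close> is arbitrary, and the guard
  keeps the recursion away from it. A tree with no branches has an empty product as argument of
  \<open>cocycle\<close>, which makes it primitive.\<close>

function cop :: "'a \<Rightarrow> ('a multiset \<times> 'a multiset \<Rightarrow>\<^sub>0 'k)" where
  "cop t = (if t \<in> T then lin_ext cocycle (\<Prod>(i, s)\<in>#dec t. tag i (cop s)) else 0)"
  by pat_completeness auto
termination
proof (relation "measure wt")
  fix t p i s assume *: "t \<in> T" "p \<in># dec t" "(i, s) = p"
  then show "(s, t) \<in> measure wt"
    using wt_child by (auto elim!: tree_cases simp: dec_B)
qed auto

declare cop.simps [simp del]

definition cop_forest :: "'a multiset \<Rightarrow> ('a multiset \<times> 'a multiset \<Rightarrow>\<^sub>0 'k)" where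
  "cop_forest F = (\<Prod>t\<in>#F. cop t)"

definition cop_tuple :: "('c \<times> 'a) multiset \<Rightarrow> (('c \<times> 'a) multiset \<times> ('c \<times> 'a) multiset \<Rightarrow>\<^sub>0 'k)" where
  "cop_tuple M = (\<Prod>(i, t)\<in>#M. tag i (cop t))"

lemma cop_B: "set_mset M \<subseteq> I \<times> T \<Longrightarrow> cop (B M) = lin_ext cocycle (cop_tuple M)"
  by (simp add: cop.simps[of "B M"] B_in_T dec_B cop_tuple_def)

lemma cop_forest_simps:
  "cop_forest {#} = 1" "cop_forest (F + G) = cop_forest F * cop_forest G"
  "cop_forest (add_mset t F) = cop t * cop_forest F"
  by (simp_all add: cop_forest_def)

lemma cop_tuple_simps:
  "cop_tuple {#} = 1" "cop_tuple (M + N) = cop_tuple M * cop_tuple N"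
  "cop_tuple (add_mset (i, t) M) = tag i (cop t) * cop_tuple M"
  by (simp_all add: cop_tuple_def)

lemma cop_tuple_tag: "cop_tuple (image_mset (Pair i) F) = tag i (cop_forest F)"
  by (induction F) (simp_all add: cop_tuple_simps cop_forest_simps tag_mult tag_one)

lemma twist_simps:
  "twist q {#} = 1" "twist q (M + N) = twist q M * twist q N"
  "twist q (add_mset (i, t) M) = (q i ^ wt t *\<^sub>k basis {#t#}) * twist q M"
  by (simp_all add: twist_def smul_mult mult_smul flip: basis_add) (simp_all add: basis_def mult_ac)

lemma twist_tag: "twist q (image_mset (Pair i) F) = q i ^ weight F *\<^sub>k basis F"
proof -
  have "(\<Prod>t\<in>#F. q i ^ wt t) = q i ^ weight F"
    by (induction F) (simp_all add: power_add)
  then show ?thesis by (simp add: twist_def multiset.map_comp comp_def)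
qed

section \<open>The coproduct respects the grading\<close>

abbreviation forest_pairs :: "nat \<Rightarrow> ('a multiset \<times> 'a multiset) set" where
  "forest_pairs m \<equiv> {(a, b). set_mset a \<subseteq> T \<and> set_mset b \<subseteq> T \<and> weight a + weight b = m}"

abbreviation tuple_pairs :: "nat \<Rightarrow> (('c \<times> 'a) multiset \<times> ('c \<times> 'a) multiset) set" where
  "tuple_pairs m \<equiv>
    {(a, b). set_mset a \<subseteq> I \<times> T \<and> set_mset b \<subseteq> I \<times> T \<and> tuple_weight a + tuple_weight b = m}"

lemma free_mod_tag:
  assumes "x \<in> free_mod (forest_pairs m)" "i \<in> I"
  shows "tag i x \<in> free_mod (tuple_pairs m)"
  unfolding tag_def
  by (rule free_mod_lin_ext)
    (use assms in \<open>auto dest!: keys_free_mod simp: multiset.map_comp comp_def\<close>)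

lemma free_mod_cop_forest:
  assumes "\<And>t. t \<in># F \<Longrightarrow> cop t \<in> free_mod (forest_pairs (wt t))"
  shows "cop_forest F \<in> free_mod (forest_pairs (weight F))"
  using assms
proof (induction F)
  case empty
  then show ?case by (auto simp: cop_forest_simps one_eq_basis_pair)
next
  case (add t F)
  have "cop t * cop_forest F \<in> free_mod (forest_pairs (wt t + weight F))"
    by (rule free_mod_mult[OF add.prems add.IH[OF add.prems]]) (simp, simp, clarsimp)
  then show ?case by (simp add: cop_forest_simps)
qed

lemma free_mod_cop_tuple:
  assumes "\<And>i t. (i, t) \<in># M \<Longrightarrow> i \<in> I \<and> cop t \<in> free_mod (forest_pairs (wt t))"
  shows "cop_tuple M \<in> free_mod (tuple_pairs (tuple_weight M))"
  using assms
proof (induction M)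
  case empty
  then show ?case by (auto simp: cop_tuple_simps one_eq_basis_pair)
next
  case (add p M)
  obtain i t where p: "p = (i, t)" by force
  have "i \<in> I" "cop t \<in> free_mod (forest_pairs (wt t))" using add.prems[of i t] p by auto
  then have "tag i (cop t) \<in> free_mod (tuple_pairs (wt t))"
    by (intro free_mod_tag)
  moreover have "cop_tuple M \<in> free_mod (tuple_pairs (tuple_weight M))"
    by (rule add.IH, rule add.prems) simp
  ultimately have "tag i (cop t) * cop_tuple M \<in> free_mod (tuple_pairs (wt t + tuple_weight M))"
    by (rule free_mod_mult) clarsimp
  then show ?case by (simp add: cop_tuple_simps p)
qed

lemma free_mod_twist:
  assumes "set_mset M \<subseteq> I \<times> T"
  shows "twist q M \<in> free_mod {F. set_mset F \<subseteq> T \<and> weight F = tuple_weight M}"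
  unfolding twist_def using assms
  by (intro free_mod_smul) (auto simp: multiset.map_comp comp_def case_prod_unfold)

lemma free_mod_join:
  assumes "set_mset M \<subseteq> I \<times> T"
  shows "join M \<in> free_mod {F. set_mset F \<subseteq> T \<and> weight F = Suc (tuple_weight M)}"
  unfolding join_def using assms by (auto simp: B_in_T wt_B)

text \<open>In either summand one factor keeps its weight under the twist while the other gains the
  new root, whence the \<open>Suc\<close>.\<close>

lemma free_mod_cocycle:
  assumes "(a, b) \<in> tuple_pairs m"
  shows "cocycle (a, b) \<in> free_mod (forest_pairs (Suc m))"
proof -
  have ab: "set_mset a \<subseteq> I \<times> T" "set_mset b \<subseteq> I \<times> T" using assms by auto
  show ?thesis
    unfolding cocycle_def prod.case
    by (intro free_mod_add)
      (rule free_mod_tensor[OF free_mod_twist[OF ab(1)] free_mod_join[OF ab(2)]],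
        use assms in auto,
       rule free_mod_tensor[OF free_mod_join[OF ab(1)] free_mod_twist[OF ab(2)]],
        use assms in auto)
qed

lemma free_mod_cop: "t \<in> T \<Longrightarrow> cop t \<in> free_mod (forest_pairs (wt t))"
proof (induction "wt t" arbitrary: t rule: less_induct)
  case less
  obtain M where M: "set_mset M \<subseteq> I \<times> T" "t = B M"
    using less.prems by (rule tree_cases)
  have "cop_tuple M \<in> free_mod (tuple_pairs (tuple_weight M))"
    by (rule free_mod_cop_tuple) (simp add: M(2) wt_child[OF M(1)] less.hyps)
  have "lin_ext cocycle (cop_tuple M) \<in> free_mod (forest_pairs (Suc (tuple_weight M)))"
  proof (intro free_mod_lin_ext)
    fix p assume "p \<in> keys (cop_tuple M)"
    with \<open>cop_tuple M \<in> _\<close> have "p \<in> tuple_pairs (tuple_weight M)"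
      by (rule keys_free_mod)
    then show "cocycle p \<in> free_mod (forest_pairs (Suc (tuple_weight M)))"
      by (cases p) (simp only: free_mod_cocycle)
  qed
  then show ?case by (simp add: M cop_B wt_B)
qed

lemma keys_cop_tuple:
  assumes "set_mset M \<subseteq> I \<times> T" "(a, b) \<in> keys (cop_tuple M)"
  shows "set_mset a \<subseteq> I \<times> T" "set_mset b \<subseteq> I \<times> T"
proof -
  have "cop_tuple M \<in> free_mod (tuple_pairs (tuple_weight M))"
    using assms free_mod_cop by (intro free_mod_cop_tuple) auto
  then have "(a, b) \<in> tuple_pairs (tuple_weight M)"
    using assms(2) by (rule keys_free_mod)
  then show "set_mset a \<subseteq> I \<times> T" "set_mset b \<subseteq> I \<times> T" by auto
qed

text \<open>The twists are morphisms of coalgebras. Both sides are multiplicative in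
  \<open>M\<close>, which leaves the case of one tree \<open>t\<close> of colour \<open>i\<close>.
  There every term of \<open>cop t\<close> has weights adding up to \<open>wt t\<close>, so the two
  twists together contribute the constant scalar \<open>q i ^ wt t\<close>.\<close>

lemma cop_twist:
  assumes "set_mset M \<subseteq> I \<times> T"
  shows "lin_ext cop_forest (twist q M) = lin_ext (\<lambda>(x, y). twist q x \<otimes> twist q y) (cop_tuple M)"
  using assms
proof (induction M)
  case empty
  show ?case
    by (simp add: twist_simps cop_tuple_simps) (simp add: one_eq_basis_pair twist_simps cop_forest_simps one_tensor_one flip: basis_zero)
next
  case (add p M)
  obtain i t where p: "p = (i, t)" by force
  then have it: "i \<in> I" "t \<in> T" using add.prems by auto
  let ?h = "lin_ext (\<lambda>(x, y). twist q x \<otimes> twist q y)"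
  have 1: "lin_ext cop_forest (x * y) = lin_ext cop_forest x * lin_ext cop_forest y" for x y
    by (rule lin_ext_mult) (simp add: cop_forest_simps)
  have 2: "?h (x * y) = ?h x * ?h y" for x y
    by (rule lin_ext_mult) (auto simp: twist_simps tensor_mult)
  have "?h (tag i (cop t)) = lin_ext (\<lambda>p. q i ^ wt t *\<^sub>k basis p) (cop t)"
    unfolding tag_def lin_ext_lin_ext
  proof (rule lin_ext_cong[OF refl])
    fix p assume p: "p \<in> keys (cop t)"
    obtain a b where [simp]: "p = (a, b)" by force
    have "wt t = weight a + weight b"
      using keys_free_mod[OF free_mod_cop[OF it(2)] p] by simp
    then show "lin_ext (\<lambda>(x, y). twist q x \<otimes> twist q y)
        (case p of (a, b) \<Rightarrow> basis (image_mset (Pair i) a, image_mset (Pair i) b)) = q i ^ wt t *\<^sub>k basis p"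
      by (simp add: twist_tag tensor_smul_left tensor_smul_right power_add mult.commute)
  qed
  also have "\<dots> = lin_ext cop_forest (q i ^ wt t *\<^sub>k basis {#t#})"
    by (simp add: lin_ext_smul_fun lin_ext_basis_id lin_ext_smul cop_forest_simps)
  finally show ?case
    using add by (simp add: p twist_simps cop_tuple_simps 1 2)
qed

lemma cop_join:
  "set_mset M \<subseteq> I \<times> T \<Longrightarrow> lin_ext cop_forest (join M) = lin_ext cocycle (cop_tuple M)"
  by (simp add: join_def cop_forest_simps cop_B)

section \<open>Coassociativity\<close>

lemma coassoc_cop_forest:
  assumes "\<And>t. t \<in># F \<Longrightarrow> coassoc_left cop_forest (cop t) = coassoc_right cop_forest (cop t)"
  shows "coassoc_left cop_forest (cop_forest F) = coassoc_right cop_forest (cop_forest F)"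
  using assms
  by (induction F)
    (simp_all add: cop_forest_simps coassoc_left_mult coassoc_right_mult coassoc_one)

text \<open>Tagging all three factors with the same position commutes with both iterated coproducts,
  so an identity between forests is carried to tuples.\<close>

lemma coassoc_tag:
  assumes "coassoc_left cop_forest x = coassoc_right cop_forest x"
  shows "coassoc_left cop_tuple (tag i x) = coassoc_right cop_tuple (tag i x)"
proof -
  let ?tag3 = "lin_ext (\<lambda>(a, b, c). basis (image_mset (Pair i) a, image_mset (Pair i) b, image_mset (Pair i) c))"
  have "coassoc_left cop_tuple (tag i x) = ?tag3 (coassoc_left cop_forest x)"
    by (simp add: coassoc_left_def tag_def lin_ext_lin_ext case_prod_unfold cop_tuple_tag
        tensor_assoc_def lin_ext_tensor)
  moreover have "coassoc_right cop_tuple (tag i x) = ?tag3 (coassoc_right cop_forest x)"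
    by (simp add: coassoc_right_def tag_def lin_ext_lin_ext case_prod_unfold cop_tuple_tag
        lin_ext_tensor tensor_lin_ext_right)
  ultimately show ?thesis using assms by simp
qed

lemma coassoc_cop_tuple:
  assumes "\<And>i t. (i, t) \<in># M \<Longrightarrow> coassoc_left cop_forest (cop t) = coassoc_right cop_forest (cop t)"
  shows "coassoc_left cop_tuple (cop_tuple M) = coassoc_right cop_tuple (cop_tuple M)"
  using assms
proof (induction M)
  case empty
  show ?case by (simp add: cop_tuple_simps coassoc_one)
next
  case (add p M)
  obtain i t where p: "p = (i, t)" by force
  then have "coassoc_left cop_tuple (tag i (cop t)) = coassoc_right cop_tuple (tag i (cop t))"
    using add.prems by (intro coassoc_tag) auto
  moreover have "coassoc_left cop_tuple (cop_tuple M) = coassoc_right cop_tuple (cop_tuple M)"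
    using add.prems by (intro add.IH) auto
  ultimately show ?case
    by (simp add: p cop_tuple_simps coassoc_left_mult coassoc_right_mult)
qed

lemma coassoc_cop:
  "t \<in> T \<Longrightarrow> coassoc_left cop_forest (cop t) = coassoc_right cop_forest (cop t)"
proof (induction "wt t" arbitrary: t rule: less_induct)
  case less
  obtain M where M: "set_mset M \<subseteq> I \<times> T" "t = B M"
    using less.prems by (rule tree_cases)
  let ?K = "\<lambda>(x, y, z). twist q1 x \<otimes> (twist q1 y \<otimes> join z) + twist q1 x \<otimes> (join y \<otimes> twist q2 z)
      + join x \<otimes> (twist q2 y \<otimes> twist q2 z)"
  \<comment> \<open>The first term of \<open>?K\<close> comes from the coproduct of
    \<open>twist q1 a\<close>; the other two come from that of \<open>join a\<close>, where
    \<open>cocycle\<close> appears again. The support condition on \<open>a\<close> is what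
    \<open>cop_twist\<close> and \<open>cop_join\<close> require.\<close>
  have L: "coassoc_left cop_forest (cocycle (a, b)) = lin_ext ?K (tensor_assoc (cop_tuple a \<otimes> basis b))"
    if "set_mset a \<subseteq> I \<times> T" for a b
  proof -
    have "coassoc_left cop_forest (cocycle (a, b)) =
        tensor_assoc (lin_ext cop_forest (twist q1 a) \<otimes> join b) +
        tensor_assoc (lin_ext cop_forest (join a) \<otimes> twist q2 b)"
      by (simp add: cocycle_def linear_add[of "coassoc_left cop_forest"] coassoc_left_tensor)
        (simp add: coassoc_left_def lin_ext_add flip: coassoc_left_tensor)
    also have "\<dots> = lin_ext ?K (tensor_assoc (cop_tuple a \<otimes> basis b))"
      by (simp add: cop_twist that cop_join tensor_lin_ext_left
          linear_lin_ext_commute[OF linear_tensor_assoc] lin_ext_plus_fun[symmetric]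
          cocycle_def case_prod_unfold tensor_add_left linear_add[OF linear_tensor_assoc]
          tensor_assoc_tensor lin_ext_lin_ext add.assoc)
        (simp add: tensor_assoc_def lin_ext_tensor lin_ext_lin_ext case_prod_unfold add.assoc)
    finally show ?thesis .
  qed
  \<comment> \<open>Here the split is different: the coproduct of \<open>join b\<close> gives the
    first two terms of \<open>?K\<close>, that of \<open>twist q2 b\<close> the third. The middle
    term is thus the one produced by \<open>join\<close> on both sides.\<close>
  have R: "coassoc_right cop_forest (cocycle (a, b)) = lin_ext ?K (basis a \<otimes> cop_tuple b)"
    if "set_mset b \<subseteq> I \<times> T" for a b
  proof -
    have "coassoc_right cop_forest (cocycle (a, b)) =
        twist q1 a \<otimes> lin_ext cop_forest (join b) + join a \<otimes> lin_ext cop_forest (twist q2 b)"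
      by (simp add: cocycle_def flip: coassoc_right_tensor) (simp add: coassoc_right_def lin_ext_add)
    also have "\<dots> = lin_ext ?K (basis a \<otimes> cop_tuple b)"
      by (simp add: cop_twist that cop_join tensor_lin_ext_right lin_ext_plus_fun[symmetric]
          cocycle_def case_prod_unfold tensor_add_right lin_ext_tensor add.assoc)
    finally show ?thesis .
  qed
  have "coassoc_left cop_forest (cop t) = lin_ext (\<lambda>p. coassoc_left cop_forest (cocycle p)) (cop_tuple M)"
    by (simp add: M cop_B coassoc_left_def lin_ext_lin_ext)
  also have "\<dots> = lin_ext (\<lambda>(a, b). lin_ext ?K (tensor_assoc (cop_tuple a \<otimes> basis b))) (cop_tuple M)"
    by (rule lin_ext_cong[OF refl]) (use L keys_cop_tuple(1)[OF M(1)] in \<open>auto\<close>)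
  also have "\<dots> = lin_ext ?K (coassoc_left cop_tuple (cop_tuple M))"
    by (simp add: coassoc_left_def lin_ext_lin_ext case_prod_unfold)
  \<comment> \<open>The induction hypothesis enters here: the branches in \<open>M\<close> have
    smaller weight, and tuples inherit coassociativity from their trees.\<close>
  also have "\<dots> = lin_ext ?K (coassoc_right cop_tuple (cop_tuple M))"
    by (subst coassoc_cop_tuple) (simp_all add: M(2) wt_child[OF M(1)] less.hyps)
  also have "\<dots> = lin_ext (\<lambda>(a, b). lin_ext ?K (basis a \<otimes> cop_tuple b)) (cop_tuple M)"
    by (simp add: coassoc_right_def lin_ext_lin_ext case_prod_unfold)
  also have "\<dots> = lin_ext (\<lambda>p. coassoc_right cop_forest (cocycle p)) (cop_tuple M)"
    by (rule lin_ext_cong[OF refl]) (use R keys_cop_tuple(2)[OF M(1)] in \<open>auto\<close>)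
  also have "\<dots> = coassoc_right cop_forest (cop t)"
    by (simp add: M cop_B coassoc_right_def lin_ext_lin_ext)
  finally show ?case .
qed

section \<open>The counit laws\<close>

lemma lookup_twist_0: "lookup (twist q M) 0 = (if M = {#} then 1 else 0)"
  by (auto simp: twist_def lookup_basis when_def)

lemma lookup_join_0: "lookup (join M) 0 = 0"
  by (simp add: join_def lookup_basis when_def)

text \<open>The counit kills every \<open>join\<close>, since a tree is not the empty forest, and it
  takes \<open>twist q a\<close> to 1 or 0 according to whether \<open>a\<close> is empty. One
  summand survives at most.\<close>

lemma eps_cocycle:
  "eps_left (cocycle (a, b)) = (if a = {#} then join b else 0)"
  "eps_right (cocycle (a, b)) = (if b = {#} then join a else 0)"
proof -
  have "eps_left (x + y) = eps_left x + eps_left y" "eps_right (x + y) = eps_right x + eps_right y"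
    for x y :: "'a multiset \<times> 'a multiset \<Rightarrow>\<^sub>0 'k"
    by (simp_all add: eps_left_def eps_right_def lin_ext_add)
  then show "eps_left (cocycle (a, b)) = (if a = {#} then join b else 0)"
    "eps_right (cocycle (a, b)) = (if b = {#} then join a else 0)"
    by (simp_all add: cocycle_def eps_left_tensor eps_right_tensor lookup_twist_0 lookup_join_0)
qed

lemma eps_left_tag:
  assumes "eps_left x = basis F"
  shows "eps_left (tag i x) = basis (image_mset (Pair i) F)"
proof -
  have "eps_left (tag i x) = lin_ext (\<lambda>a. basis (image_mset (Pair i) a)) (eps_left x)"
    unfolding eps_left_def tag_def lin_ext_lin_ext
    by (rule lin_ext_cong) (auto simp: lin_ext_zero)
  then show ?thesis using assms by simp
qed

lemma eps_right_tag:
  assumes "eps_right x = basis F"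
  shows "eps_right (tag i x) = basis (image_mset (Pair i) F)"
proof -
  have "eps_right (tag i x) = lin_ext (\<lambda>a. basis (image_mset (Pair i) a)) (eps_right x)"
    unfolding eps_right_def tag_def lin_ext_lin_ext
    by (rule lin_ext_cong) (auto simp: lin_ext_zero)
  then show ?thesis using assms by simp
qed

lemma eps_cop_tuple:
  assumes "\<And>i t. (i, t) \<in># M \<Longrightarrow> eps_left (cop t) = basis {#t#} \<and> eps_right (cop t) = basis {#t#}"
  shows "eps_left (cop_tuple M) = basis M \<and> eps_right (cop_tuple M) = basis M"
  using assms
proof (induction M)
  case empty
  show ?case by (simp add: cop_tuple_simps eps_one basis_zero)
next
  case (add p M)
  obtain i t where p: "p = (i, t)" by force
  then have "eps_left (tag i (cop t)) = basis {#p#}" "eps_right (tag i (cop t)) = basis {#p#}"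
    using add.prems[of i t] eps_left_tag[of "cop t" "{#t#}" i] eps_right_tag[of "cop t" "{#t#}" i] by auto
  moreover have "eps_left (cop_tuple M) = basis M \<and> eps_right (cop_tuple M) = basis M"
    using add.prems by (intro add.IH) auto
  ultimately show ?case
    by (simp add: p cop_tuple_simps eps_mult flip: basis_add)
qed

text \<open>Applying the counit to \<open>cocycle\<close> amounts to applying it to the tuple and
  then \<open>join\<close>. By induction the tuple satisfies the counit law, so what remains is
  \<open>join M\<close>, the tree itself.\<close>

lemma eps_cop: "t \<in> T \<Longrightarrow> eps_left (cop t) = basis {#t#} \<and> eps_right (cop t) = basis {#t#}"
proof (induction "wt t" arbitrary: t rule: less_induct)
  case less
  obtain M where M: "set_mset M \<subseteq> I \<times> T" "t = B M"
    using less.prems by (rule tree_cases)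
  have *: "eps_left (cop_tuple M) = basis M \<and> eps_right (cop_tuple M) = basis M"
    by (rule eps_cop_tuple) (simp add: M(2) wt_child[OF M(1)] less.hyps)
  have "eps_left (cop t) = lin_ext (\<lambda>p. eps_left (cocycle p)) (cop_tuple M)"
    by (simp add: M cop_B eps_left_def lin_ext_lin_ext)
  also have "\<dots> = lin_ext join (eps_left (cop_tuple M))"
    unfolding eps_left_def[where 'b = "('c \<times> 'a) multiset"] lin_ext_lin_ext
    by (rule lin_ext_cong) (auto simp: eps_cocycle lin_ext_zero)
  also have "\<dots> = basis {#t#}" using * M by (simp add: join_def)
  finally have 1: "eps_left (cop t) = basis {#t#}" .
  have "eps_right (cop t) = lin_ext (\<lambda>p. eps_right (cocycle p)) (cop_tuple M)"
    by (simp add: M cop_B eps_right_def lin_ext_lin_ext)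
  also have "\<dots> = lin_ext join (eps_right (cop_tuple M))"
    unfolding eps_right_def[where 'b = "('c \<times> 'a) multiset"] lin_ext_lin_ext
    by (rule lin_ext_cong) (auto simp: eps_cocycle lin_ext_zero)
  also have "\<dots> = basis {#t#}" using * M by (simp add: join_def)
  finally show ?case using 1 by simp
qed

lemma eps_cop_forest:
  assumes "set_mset F \<subseteq> T"
  shows "eps_left (cop_forest F) = basis F" "eps_right (cop_forest F) = basis F"
  using assms
  by (induction F)
    (simp_all add: cop_forest_simps eps_one eps_mult eps_cop basis_zero flip: basis_add)

sublocale graded_bialgebra "{F. set_mset F \<subseteq> T}" weight cop_forest
proof
  fix b :: "'a multiset" assume "b \<in> {F. set_mset F \<subseteq> T}"
  then have b: "set_mset b \<subseteq> T" by simp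
  show "weight b = 0 \<longleftrightarrow> b = 0" using weight_eq_0_iff[OF b] by simp
  show "cop_forest b \<in> free_mod {(a, c). a \<in> {F. set_mset F \<subseteq> T} \<and> c \<in> {F. set_mset F \<subseteq> T}
      \<and> weight a + weight c = weight b}"
    using free_mod_cop_forest[of b] free_mod_cop b by auto
  show "lin_ext (\<lambda>(a, c). if a = 0 then basis c else 0) (cop_forest b) = basis b"
    using eps_cop_forest(1)[OF b] by (simp add: eps_left_def)
  show "lin_ext (\<lambda>(a, c). if c = 0 then basis a else 0) (cop_forest b) = basis b"
    using eps_cop_forest(2)[OF b] by (simp add: eps_right_def)
  have "coassoc_left cop_forest (cop_forest b) = coassoc_right cop_forest (cop_forest b)"
    using b by (intro coassoc_cop_forest coassoc_cop) auto
  then show "lin_ext (\<lambda>(a, c). lin_ext (\<lambda>(a', a''). basis (a', a'', c)) (cop_forest a)) (cop_forest b) =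
      lin_ext (\<lambda>(a, c). lin_ext (\<lambda>(c', c''). basis (a, c', c'')) (cop_forest c)) (cop_forest b)"
    by (simp add: coassoc_left_def coassoc_right_def tensor_assoc_def lin_ext_tensor
        tensor_lin_ext[where x = "basis a" for a] case_prod_unfold)
qed (auto simp: cop_forest_simps)

end

section \<open>Tree posets and their branches\<close>

lemma edges_iff: "(v, w) \<in> edges P \<longleftrightarrow>
    (v, w) \<in> le P \<and> v \<noteq> w \<and> (\<forall>x. (v, x) \<in> le P \<longrightarrow> (x, w) \<in> le P \<longrightarrow> x = v \<or> x = w)"
  unfolding edges_def less_in_def by auto

text \<open>A working form with the reflexive order throughout, in which two elements below a common
  one are comparable without side conditions.\<close>

lemma tree_poset_iff: "tree_poset P \<longleftrightarrow>
    finite (verts P) \<and> le P \<subseteq> verts P \<times> verts P \<and> (\<forall>x\<in>verts P. (x, x) \<in> le P) \<and>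
    trans (le P) \<and> antisym (le P) \<and> (\<exists>r\<in>verts P. \<forall>x\<in>verts P. (r, x) \<in> le P) \<and>
    (\<forall>x y z. (y, x) \<in> le P \<longrightarrow> (z, x) \<in> le P \<longrightarrow> (y, z) \<in> le P \<or> (z, y) \<in> le P)"
  (is "_ \<longleftrightarrow> ?R")
proof
  assume t: "tree_poset P"
  then have 1: "le P \<subseteq> verts P \<times> verts P" "\<forall>x\<in>verts P. (x, x) \<in> le P" "trans (le P)" "antisym (le P)"
    by (auto simp: tree_poset_def partial_order_on_def preorder_on_def refl_on_def)
  have "(y, z) \<in> le P \<or> (z, y) \<in> le P" if "(y, x) \<in> le P" "(z, x) \<in> le P" for x y z
  \<comment> \<open>The definition speaks of distinct elements strictly below \<open>x\<close>; the
    degenerate cases follow from reflexivity or from the assumptions themselves.\<close>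
  proof (cases "y = z \<or> y = x \<or> z = x")
    case True
    then show ?thesis using that 1 by auto
  next
    case False
    then show ?thesis using t that 1(1) unfolding tree_poset_def less_in_def by blast
  qed
  then show ?R using 1 t unfolding tree_poset_def by blast
next
  assume R: ?R
  then have "partial_order_on (verts P) (le P)"
    by (simp add: partial_order_on_def preorder_on_def refl_on_def)
  moreover have "\<forall>x\<in>verts P. \<forall>y\<in>verts P. \<forall>z\<in>verts P.
        y \<noteq> z \<longrightarrow> less_in P y x \<longrightarrow> less_in P z x \<longrightarrow> less_in P y z \<or> less_in P z y"
    using R unfolding less_in_def by blast
  ultimately show "tree_poset P" using R by (simp add: tree_poset_def)
qed

lemma tree_posetD:
  assumes "tree_poset P"
  shows "finite (verts P)"
    and "(x, y) \<in> le P \<Longrightarrow> x \<in> verts P" "(x, y) \<in> le P \<Longrightarrow> y \<in> verts P"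
    and "x \<in> verts P \<Longrightarrow> (x, x) \<in> le P"
    and "(x, y) \<in> le P \<Longrightarrow> (y, z) \<in> le P \<Longrightarrow> (x, z) \<in> le P"
    and "(x, y) \<in> le P \<Longrightarrow> (y, x) \<in> le P \<Longrightarrow> x = y"
    and "(y, x) \<in> le P \<Longrightarrow> (z, x) \<in> le P \<Longrightarrow> (y, z) \<in> le P \<or> (z, y) \<in> le P"
  using assms unfolding tree_poset_iff by (auto dest: transD antisymD)

definition root :: "cposet \<Rightarrow> nat" where
  "root P = (THE r. r \<in> verts P \<and> (\<forall>x\<in>verts P. (r, x) \<in> le P))"

lemma root_eqI:
  assumes "tree_poset P" "r \<in> verts P" "\<And>x. x \<in> verts P \<Longrightarrow> (r, x) \<in> le P"
  shows "root P = r"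
  unfolding root_def using assms tree_posetD(6)[OF assms(1)] by (intro the_equality) auto

lemma root_least:
  assumes "tree_poset P"
  shows "root P \<in> verts P" "x \<in> verts P \<Longrightarrow> (root P, x) \<in> le P"
proof -
  obtain r where "r \<in> verts P" "\<forall>x\<in>verts P. (r, x) \<in> le P"
    using assms by (auto simp: tree_poset_iff)
  moreover from this have "root P = r" using root_eqI[OF assms] by blast
  ultimately show "root P \<in> verts P" "x \<in> verts P \<Longrightarrow> (root P, x) \<in> le P" by auto
qed

lemma le_root:
  assumes "tree_poset P" "(x, root P) \<in> le P"
  shows "x = root P"
  using assms root_least tree_posetD by metis

definition children :: "cposet \<Rightarrow> nat set" where
  "children P = {c. (root P, c) \<in> edges P}"

text \<open>The branch growing from \<open>c\<close>. In the order only \<open>x\<close> is asked to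
  lie above \<open>c\<close>: for \<open>y\<close> this follows by transitivity.\<close>

definition sub_poset :: "cposet \<Rightarrow> nat \<Rightarrow> cposet" where
  "sub_poset P c = CPoset {x. (c, x) \<in> le P} {(x, y). (x, y) \<in> le P \<and> (c, x) \<in> le P} (col P)"

lemma sub_poset_sel [simp]:
  "verts (sub_poset P c) = {x. (c, x) \<in> le P}"
  "(x, y) \<in> le (sub_poset P c) \<longleftrightarrow> (x, y) \<in> le P \<and> (c, x) \<in> le P"
  "col (sub_poset P c) = col P"
  by (simp_all add: sub_poset_def)

lemma tree_poset_sub:
  assumes P: "tree_poset P" and c: "c \<in> verts P"
  shows "tree_poset (sub_poset P c)"
  unfolding tree_poset_iff
proof (intro conjI)
  note D = tree_posetD[OF P]
  show "finite (verts (sub_poset P c))"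
    by (rule finite_subset[OF _ D(1)]) (auto intro: D(3))
  show "le (sub_poset P c) \<subseteq> verts (sub_poset P c) \<times> verts (sub_poset P c)"
    by (auto intro: D(5))
  show "\<forall>x\<in>verts (sub_poset P c). (x, x) \<in> le (sub_poset P c)"
    by (auto intro: D(4) D(3))
  show "trans (le (sub_poset P c))"
    by (rule transI) (auto intro: D(5))
  show "antisym (le (sub_poset P c))"
    by (rule antisymI) (auto intro: D(6))
  show "\<exists>r\<in>verts (sub_poset P c). \<forall>x\<in>verts (sub_poset P c). (r, x) \<in> le (sub_poset P c)"
    using D(4)[OF c] by auto
  show "\<forall>x y z. (y, x) \<in> le (sub_poset P c) \<longrightarrow> (z, x) \<in> le (sub_poset P c) \<longrightarrow>
      (y, z) \<in> le (sub_poset P c) \<or> (z, y) \<in> le (sub_poset P c)"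
    using D(7) by auto
qed

lemma root_sub:
  assumes "tree_poset P" "c \<in> verts P"
  shows "root (sub_poset P c) = c"
  using assms by (intro root_eqI tree_poset_sub) (auto dest: tree_posetD)

text \<open>An up-set is convex: whatever lies between \<open>x\<close> and \<open>y\<close> lies
  above \<open>c\<close> as soon as \<open>x\<close> does, so covering means the same in both
  posets.\<close>

lemma edges_sub:
  assumes "tree_poset P"
  shows "(x, y) \<in> edges (sub_poset P c) \<longleftrightarrow> (x, y) \<in> edges P \<and> (c, x) \<in> le P"
  using tree_posetD(5)[OF assms] by (auto simp: edges_iff)

lemma children_verts: "tree_poset P \<Longrightarrow> c \<in> children P \<Longrightarrow> c \<in> verts P"
  by (auto simp: children_def edges_iff dest: tree_posetD)

lemma finite_children: "tree_poset P \<Longrightarrow> finite (children P)"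
  by (rule finite_subset[of _ "verts P"]) (auto dest: children_verts tree_posetD)

lemma child_not_root:
  assumes "tree_poset P" "c \<in> children P"
  shows "(c, root P) \<notin> le P"
  using assms le_root[of P c] by (auto simp: children_def edges_iff)

text \<open>Elements below a common \<open>x\<close> are comparable in a tree, and of two comparable
  elements that both cover the root neither can be strictly below the other.\<close>

lemma child_unique:
  assumes P: "tree_poset P" and c: "c \<in> children P" "d \<in> children P"
    and "(c, x) \<in> le P" "(d, x) \<in> le P"
  shows "c = d"
proof -
  have "(c, d) \<in> le P \<or> (d, c) \<in> le P"
    using assms tree_posetD(7) by metis
  moreover have "(root P, c) \<in> le P" "(root P, d) \<in> le P"
    using P c children_verts root_least by auto
  ultimately show ?thesis
    using c unfolding children_def edges_iff mem_Collect_eq by metis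
qed

text \<open>A minimal element among the non-root elements below \<open>x\<close> covers the root; it
  exists because a finite strict order is well-founded.\<close>

lemma child_exists:
  assumes P: "tree_poset P" and x: "x \<in> verts P" "x \<noteq> root P"
  obtains c where "c \<in> children P" "(c, x) \<in> le P"
proof -
  have "finite (le P)"
    using P unfolding tree_poset_iff by (meson finite_SigmaI finite_subset)
  then have "wf (le P - Id)"
    using P by (intro partial_order_on_well_order_on) (auto simp: tree_poset_def)
  moreover have "x \<in> {y. (y, x) \<in> le P \<and> y \<noteq> root P}"
    using x P by (auto dest: tree_posetD)
  ultimately obtain c where c: "(c, x) \<in> le P" "c \<noteq> root P"
    and min: "\<And>y. (y, c) \<in> le P - Id \<Longrightarrow> y \<notin> {y. (y, x) \<in> le P \<and> y \<noteq> root P}"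
    by (rule wfE_min) blast
  have "y = root P \<or> y = c" if "(y, c) \<in> le P" for y
    using min[of y] that c tree_posetD(5)[OF P that c(1)] by auto
  moreover have "(root P, c) \<in> le P"
    using root_least(2)[OF P] tree_posetD(2)[OF P c(1)] .
  ultimately have "(root P, c) \<in> edges P"
    unfolding edges_iff using c(2) by auto
  then show thesis using that c by (auto simp: children_def)
qed

lemma verts_decomp:
  assumes P: "tree_poset P"
  shows "verts P = {root P} \<union> (\<Union>c\<in>children P. {x. (c, x) \<in> le P})"
    "root P \<notin> (\<Union>c\<in>children P. {x. (c, x) \<in> le P})"
    "disjoint_family_on (\<lambda>c. {x. (c, x) \<in> le P}) (children P)"
proof -
  show "verts P = {root P} \<union> (\<Union>c\<in>children P. {x. (c, x) \<in> le P})"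
  proof (intro equalityI subsetI)
    fix x assume "x \<in> verts P"
    then show "x \<in> {root P} \<union> (\<Union>c\<in>children P. {x. (c, x) \<in> le P})"
      by (cases "x = root P") (auto elim: child_exists[OF P])
  qed (auto intro: root_least(1)[OF P] tree_posetD(3)[OF P])
  show "root P \<notin> (\<Union>c\<in>children P. {x. (c, x) \<in> le P})"
    using child_not_root[OF P] by auto
  show "disjoint_family_on (\<lambda>c. {x. (c, x) \<in> le P}) (children P)"
    using child_unique[OF P] unfolding disjoint_family_on_def by blast
qed

lemma edge_cases:
  assumes P: "tree_poset P" and e: "(x, y) \<in> edges P"
  obtains "x = root P" "y \<in> children P"
  | c where "c \<in> children P" "(x, y) \<in> edges (sub_poset P c)"
proof (cases "x = root P")
  case True
  then show ?thesis using that(1) e by (simp add: children_def)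
next
  case False
  moreover have "x \<in> verts P" using e P by (auto simp: edges_iff dest: tree_posetD)
  ultimately obtain c where "c \<in> children P" "(c, x) \<in> le P" using child_exists[OF P] by metis
  then show ?thesis using that(2) e edges_sub[OF P] by blast
qed

section \<open>Isomorphisms of tree posets\<close>

definition iso_by :: "(nat \<Rightarrow> nat) \<Rightarrow> cposet \<Rightarrow> cposet \<Rightarrow> bool" where
  "iso_by \<phi> P Q \<longleftrightarrow> bij_betw \<phi> (verts P) (verts Q) \<and>
     (\<forall>x\<in>verts P. \<forall>y\<in>verts P. (x, y) \<in> le P \<longleftrightarrow> (\<phi> x, \<phi> y) \<in> le Q) \<and>
     (\<forall>x y. (x, y) \<in> edges P \<longrightarrow> col Q (\<phi> x, \<phi> y) = col P (x, y))"

lemma cposet_iso_iff: "cposet_iso P Q \<longleftrightarrow> (\<exists>\<phi>. iso_by \<phi> P Q)"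
  unfolding cposet_iso_def iso_by_def by (simp add: Ball_def)

lemma iso_byD:
  assumes "iso_by \<phi> P Q"
  shows "bij_betw \<phi> (verts P) (verts Q)"
    "x \<in> verts P \<Longrightarrow> y \<in> verts P \<Longrightarrow> (\<phi> x, \<phi> y) \<in> le Q \<longleftrightarrow> (x, y) \<in> le P"
    "(x, y) \<in> edges P \<Longrightarrow> col Q (\<phi> x, \<phi> y) = col P (x, y)"
    "x \<in> verts P \<Longrightarrow> \<phi> x \<in> verts Q"
    "x \<in> verts P \<Longrightarrow> y \<in> verts P \<Longrightarrow> \<phi> x = \<phi> y \<longleftrightarrow> x = y"
  using assms unfolding iso_by_def by (auto simp: bij_betw_def inj_on_def)

lemma iso_by_edges:
  assumes P: "tree_poset P" and Q: "tree_poset Q" and i: "iso_by \<phi> P Q"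
    and xy: "x \<in> verts P" "y \<in> verts P"
  shows "(\<phi> x, \<phi> y) \<in> edges Q \<longleftrightarrow> (x, y) \<in> edges P"
proof -
  note D = iso_byD[OF i]
  \<comment> \<open>Covering quantifies over all natural numbers, whereas \<open>\<phi>\<close> is
    controlled only on vertices. The quantifier is narrowed to vertices, transported, and widened
    again.\<close>
  have "(\<forall>z. (\<phi> x, z) \<in> le Q \<longrightarrow> (z, \<phi> y) \<in> le Q \<longrightarrow> z = \<phi> x \<or> z = \<phi> y) \<longleftrightarrow>
        (\<forall>z\<in>verts Q. (\<phi> x, z) \<in> le Q \<longrightarrow> (z, \<phi> y) \<in> le Q \<longrightarrow> z = \<phi> x \<or> z = \<phi> y)"
    using tree_posetD(2,3)[OF Q] by blast
  also have "verts Q = \<phi> ` verts P"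
    using D(1) by (simp add: bij_betw_def)
  also have "(\<forall>z\<in>\<phi> ` verts P. (\<phi> x, z) \<in> le Q \<longrightarrow> (z, \<phi> y) \<in> le Q \<longrightarrow> z = \<phi> x \<or> z = \<phi> y) \<longleftrightarrow>
        (\<forall>z\<in>verts P. (x, z) \<in> le P \<longrightarrow> (z, y) \<in> le P \<longrightarrow> z = x \<or> z = y)"
    using xy D(2,5) by auto
  also have "\<dots> \<longleftrightarrow> (\<forall>z. (x, z) \<in> le P \<longrightarrow> (z, y) \<in> le P \<longrightarrow> z = x \<or> z = y)"
    using tree_posetD(2,3)[OF P] by blast
  finally show ?thesis
    unfolding edges_iff using xy D(2,5) by simp
qed

lemma iso_by_root:
  assumes P: "tree_poset P" and Q: "tree_poset Q" and i: "iso_by \<phi> P Q"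
  shows "\<phi> (root P) = root Q"
proof -
  note D = iso_byD[OF i]
  have "(\<phi> (root P), y) \<in> le Q" if "y \<in> verts Q" for y
  proof -
    obtain x where "x \<in> verts P" "y = \<phi> x" using D(1) \<open>y \<in> verts Q\<close> by (auto simp: bij_betw_def)
    then show ?thesis using D(2) root_least[OF P] by simp
  qed
  then show ?thesis using root_eqI[OF Q D(4)] root_least[OF P] by simp
qed

lemma cposet_iso_refl: "cposet_iso P P"
  unfolding cposet_iso_iff iso_by_def by (rule exI[of _ id]) auto

lemma cposet_iso_sym:
  assumes P: "tree_poset P" and Q: "tree_poset Q" and "cposet_iso P Q"
  shows "cposet_iso Q P"
proof -
  obtain \<phi> where i: "iso_by \<phi> P Q" using assms(3) by (auto simp: cposet_iso_iff)
  note D = iso_byD[OF i]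
  let ?\<psi> = "inv_into (verts P) \<phi>"
  have \<psi>: "?\<psi> y \<in> verts P" "\<phi> (?\<psi> y) = y" if "y \<in> verts Q" for y
    using that D(1) by (auto simp: bij_betw_def inv_into_into f_inv_into_f)
  have "iso_by ?\<psi> Q P"
    unfolding iso_by_def
  proof (intro conjI ballI allI impI)
    show "bij_betw ?\<psi> (verts Q) (verts P)" using D(1) by (rule bij_betw_inv_into)
    show "(x, y) \<in> le Q \<longleftrightarrow> (?\<psi> x, ?\<psi> y) \<in> le P" if "x \<in> verts Q" "y \<in> verts Q" for x y
      using D(2)[OF \<psi>(1)[OF that(1)] \<psi>(1)[OF that(2)]] \<psi>(2) that by simp
    show "col P (?\<psi> x, ?\<psi> y) = col Q (x, y)" if "(x, y) \<in> edges Q" for x y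
    proof -
      have xy: "x \<in> verts Q" "y \<in> verts Q" using that Q by (auto simp: edges_iff dest: tree_posetD)
      then have "(?\<psi> x, ?\<psi> y) \<in> edges P"
        using iso_by_edges[OF P Q i \<psi>(1)[OF xy(1)] \<psi>(1)[OF xy(2)]] \<psi>(2) that by simp
      from D(3)[OF this] show ?thesis using \<psi>(2) xy by simp
    qed
  qed
  then show ?thesis by (auto simp: cposet_iso_iff)
qed

lemma cposet_iso_trans:
  assumes P: "tree_poset P" and Q: "tree_poset Q" and "cposet_iso P Q" "cposet_iso Q R"
  shows "cposet_iso P R"
proof -
  obtain \<phi> \<psi> where i: "iso_by \<phi> P Q" and j: "iso_by \<psi> Q R" using assms(3,4) by (auto simp: cposet_iso_iff)
  have "iso_by (\<psi> \<circ> \<phi>) P R"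
    unfolding iso_by_def
  proof (intro conjI ballI allI impI)
    show "bij_betw (\<psi> \<circ> \<phi>) (verts P) (verts R)"
      using iso_byD(1)[OF i] iso_byD(1)[OF j] by (rule bij_betw_trans)
    show "(x, y) \<in> le P \<longleftrightarrow> ((\<psi> \<circ> \<phi>) x, (\<psi> \<circ> \<phi>) y) \<in> le R" if "x \<in> verts P" "y \<in> verts P" for x y
      using iso_byD(2,4)[OF i] iso_byD(2)[OF j] that by simp
    show "col R ((\<psi> \<circ> \<phi>) x, (\<psi> \<circ> \<phi>) y) = col P (x, y)" if e: "(x, y) \<in> edges P" for x y
    proof -
      have "x \<in> verts P" "y \<in> verts P" using e P by (auto simp: edges_iff dest: tree_posetD)
      then have "(\<phi> x, \<phi> y) \<in> edges Q" using iso_by_edges[OF P Q i] e by simp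
      then show ?thesis using iso_byD(3)[OF i e] iso_byD(3)[OF j] by simp
    qed
  qed
  then show ?thesis by (auto simp: cposet_iso_iff)
qed

lemma iso_class_eq_iff:
  assumes "tree_poset P" "tree_poset Q"
  shows "iso_class P = iso_class Q \<longleftrightarrow> cposet_iso P Q"
proof
  assume "iso_class P = iso_class Q"
  moreover have "Q \<in> iso_class Q" using assms(2) cposet_iso_refl by (simp add: iso_class_def)
  ultimately have "Q \<in> iso_class P" by simp
  then show "cposet_iso P Q" by (simp add: iso_class_def)
next
  assume *: "cposet_iso P Q"
  show "iso_class P = iso_class Q"
    using cposet_iso_trans[OF assms(2,1) cposet_iso_sym[OF assms *]]
      cposet_iso_trans[OF assms *] by (auto simp: iso_class_def)
qed

lemma rep_iso_class:
  assumes "tree_poset P"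
  shows "tree_poset (rep (iso_class P))" "iso_class (rep (iso_class P)) = iso_class P"
proof -
  have "rep (iso_class P) \<in> iso_class P"
    unfolding rep_def
    by (rule someI[of "\<lambda>Q. Q \<in> iso_class P" P]) (simp add: iso_class_def assms cposet_iso_refl)
  then have "tree_poset (rep (iso_class P))" "cposet_iso P (rep (iso_class P))"
    unfolding iso_class_def by blast+
  then show "tree_poset (rep (iso_class P))" "iso_class (rep (iso_class P)) = iso_class P"
    using iso_class_eq_iff[OF assms, of "rep (iso_class P)"] by simp_all
qed

lemma tree_size_iso_class:
  assumes "tree_poset P"
  shows "tree_size (iso_class P) = card (verts P)"
proof -
  have "cposet_iso P (rep (iso_class P))"
    using iso_class_eq_iff[OF assms rep_iso_class(1)[OF assms]] rep_iso_class(2)[OF assms] by simp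
  then show ?thesis
    unfolding cposet_iso_iff tree_size_def using iso_byD(1) bij_betw_same_card by metis
qed

section \<open>The multiset of branches as a complete invariant\<close>

definition branch_mset :: "cposet \<Rightarrow> (nat \<times> ctree) multiset" where
  "branch_mset P = image_mset (\<lambda>c. (col P (root P, c), iso_class (sub_poset P c))) (mset_set (children P))"

lemma branch_mset_iso:
  assumes P: "tree_poset P" and Q: "tree_poset Q" and "cposet_iso P Q"
  shows "branch_mset P = branch_mset Q"
proof -
  obtain \<phi> where i: "iso_by \<phi> P Q" using assms(3) by (auto simp: cposet_iso_iff)
  note D = iso_byD[OF i]
  have r: "\<phi> (root P) = root Q" using iso_by_root[OF P Q i] .
  have children: "\<phi> ` children P = children Q"
  proof
    show "\<phi> ` children P \<subseteq> children Q"
      using iso_by_edges[OF P Q i root_least(1)[OF P]] children_verts[OF P]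
      by (auto simp: children_def r)
    show "children Q \<subseteq> \<phi> ` children P"
    proof
      fix d assume d: "d \<in> children Q"
      then obtain c where c: "c \<in> verts P" "d = \<phi> c"
        using children_verts[OF Q] D(1) by (auto simp: bij_betw_def)
      then show "d \<in> \<phi> ` children P"
        using d iso_by_edges[OF P Q i root_least(1)[OF P] c(1)] by (auto simp: children_def r)
    qed
  qed
  moreover have inj: "inj_on \<phi> (children P)"
    using D(5) children_verts[OF P] by (auto intro!: inj_onI)
  moreover have "iso_class (sub_poset P c) = iso_class (sub_poset Q (\<phi> c))" if c: "c \<in> children P" for c
  proof -
    have cv: "c \<in> verts P" using children_verts[OF P c] .
    have "iso_by \<phi> (sub_poset P c) (sub_poset Q (\<phi> c))"
      unfolding iso_by_def
    proof (intro conjI ballI allI impI)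
      show "bij_betw \<phi> (verts (sub_poset P c)) (verts (sub_poset Q (\<phi> c)))"
        unfolding bij_betw_def
      proof
        show "inj_on \<phi> (verts (sub_poset P c))"
          using D(5) tree_posetD(3)[OF P] by (auto intro!: inj_onI)
        show "\<phi> ` verts (sub_poset P c) = verts (sub_poset Q (\<phi> c))"
        proof (intro equalityI subsetI)
          fix y assume "y \<in> \<phi> ` verts (sub_poset P c)"
          then show "y \<in> verts (sub_poset Q (\<phi> c))"
            using D(2)[OF cv] tree_posetD(3)[OF P] by auto
        next
          fix y assume y: "y \<in> verts (sub_poset Q (\<phi> c))"
          then obtain x where "x \<in> verts P" "y = \<phi> x"
            using tree_posetD(3)[OF Q, of "\<phi> c" y] D(1) by (auto simp: bij_betw_def)
          then show "y \<in> \<phi> ` verts (sub_poset P c)"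
            using y D(2)[OF cv] by auto
        qed
      qed
      show "(x, y) \<in> le (sub_poset P c) \<longleftrightarrow> (\<phi> x, \<phi> y) \<in> le (sub_poset Q (\<phi> c))"
        if "x \<in> verts (sub_poset P c)" "y \<in> verts (sub_poset P c)" for x y
        using that D(2) cv tree_posetD(3)[OF P] by auto
      show "col (sub_poset Q (\<phi> c)) (\<phi> x, \<phi> y) = col (sub_poset P c) (x, y)"
        if "(x, y) \<in> edges (sub_poset P c)" for x y
        using that D(3) by (simp add: edges_sub[OF P])
    qed
    then have "cposet_iso (sub_poset P c) (sub_poset Q (\<phi> c))"
      by (auto simp: cposet_iso_iff)
    then show ?thesis
      using iso_class_eq_iff tree_poset_sub[OF P cv] tree_poset_sub[OF Q D(4)[OF cv]] by blast
  qed
  moreover have "col Q (root Q, \<phi> c) = col P (root P, c)" if "c \<in> children P" for c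
    using D(3) that by (simp add: children_def r[symmetric])
  ultimately show ?thesis
    unfolding branch_mset_def
    by (simp flip: children image_mset_mset_set[OF inj] add: multiset.map_comp comp_def)
      (rule image_mset_cong, use finite_children[OF P] in auto)
qed

text \<open>Turns equality of two multisets of labels into a matching of the labelled elements,
  built by pairing off one element at a time. It is used to match the children of two roots.\<close>

lemma image_mset_eq_bij:
  assumes "finite A" "finite B" "image_mset f (mset_set A) = image_mset g (mset_set B)"
  obtains h where "bij_betw h A B" "\<And>a. a \<in> A \<Longrightarrow> g (h a) = f a"
proof -
  have "\<exists>h. bij_betw h A B \<and> (\<forall>a\<in>A. g (h a) = f a)"
    using assms
  proof (induction A arbitrary: B rule: finite_induct)
    case empty
    then have "B = {}" by (simp add: mset_set_empty_iff)
    then show ?case by (simp add: bij_betw_def)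
  next
    case (insert a A)
    have eq: "add_mset (f a) (image_mset f (mset_set A)) = image_mset g (mset_set B)"
      using insert by simp
    then have "f a \<in># image_mset g (mset_set B)" by (metis union_single_eq_member)
    then obtain b where b: "b \<in> B" "g b = f a" using insert.prems by auto
    have "mset_set B = add_mset b (mset_set (B - {b}))"
      using b insert.prems by (simp add: mset_set.remove)
    then have "image_mset f (mset_set A) = image_mset g (mset_set (B - {b}))"
      using eq b by simp
    then obtain h where h: "bij_betw h A (B - {b})" "\<forall>a\<in>A. g (h a) = f a"
      using insert.IH[of "B - {b}"] insert.prems by auto
    let ?h = "h(a := b)"
    have "bij_betw ?h A (B - {b})"
      using h(1) insert.hyps by (subst bij_betw_cong[of A ?h h]) auto
    then have "bij_betw ?h (insert a A) (insert b (B - {b}))"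
      using insert.hyps notIn_Un_bij_betw[of a A ?h "B - {b}"] by simp
    then have "bij_betw ?h (insert a A) B"
      using b by (simp add: insert_absorb)
    moreover have "\<forall>x\<in>insert a A. g (?h x) = f x"
      using h(2) b insert.hyps by auto
    ultimately show ?case by blast
  qed
  then show thesis using that by blast
qed

text \<open>Matched children carry isomorphic branches and equally coloured edges to the root. Since
  a tree is the disjoint union of its root and its branches, the isomorphisms of the branches
  glue.\<close>

lemma cposet_iso_if_branch_mset_eq:
  assumes P: "tree_poset P" and Q: "tree_poset Q" and eq: "branch_mset P = branch_mset Q"
  shows "cposet_iso P Q"
proof -
  obtain h where h: "bij_betw h (children P) (children Q)"
    and hc: "\<And>c. c \<in> children P \<Longrightarrow>
      (col Q (root Q, h c), iso_class (sub_poset Q (h c))) = (col P (root P, c), iso_class (sub_poset P c))"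
    using eq unfolding branch_mset_def
    by (rule image_mset_eq_bij[OF finite_children[OF P] finite_children[OF Q]]) blast
  have hQ: "h c \<in> children Q" if "c \<in> children P" for c
    using h that by (auto simp: bij_betw_def)
  have "\<exists>\<psi>. iso_by \<psi> (sub_poset P c) (sub_poset Q (h c))" if "c \<in> children P" for c
    unfolding cposet_iso_iff[symmetric]
    using iso_class_eq_iff[OF tree_poset_sub[OF P children_verts[OF P that]]
        tree_poset_sub[OF Q children_verts[OF Q hQ[OF that]]]] hc[OF that] by (metis prod.inject)
  then obtain \<psi> where \<psi>: "\<And>c. c \<in> children P \<Longrightarrow> iso_by (\<psi> c) (sub_poset P c) (sub_poset Q (h c))"
    by metis
  \<comment> \<open>A vertex other than the root lies above exactly one child, which selects the
    branch isomorphism to apply.\<close>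
  define \<phi> where "\<phi> x = (if x = root P then root Q else \<psi> (THE c. c \<in> children P \<and> (c, x) \<in> le P) x)" for x
  have \<phi>r: "\<phi> (root P) = root Q" by (simp add: \<phi>_def)
  have \<phi>: "\<phi> x = \<psi> c x" if "c \<in> children P" "(c, x) \<in> le P" for c x
  proof -
    have "x \<noteq> root P" using child_not_root[OF P that(1)] that(2) by auto
    moreover have "(THE c. c \<in> children P \<and> (c, x) \<in> le P) = c"
      using that child_unique[OF P] by (intro the_equality) auto
    ultimately show ?thesis by (simp add: \<phi>_def)
  qed
  have \<phi>h: "(h c, \<phi> x) \<in> le Q" if "c \<in> children P" "(c, x) \<in> le P" for c x
    using iso_byD(4)[OF \<psi>[OF that(1)], of x] that by (simp add: \<phi>)
  \<comment> \<open>A child is the root of its own branch and isomorphisms preserve roots; this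
    makes the colours of the edges at the root agree.\<close>
  have \<phi>c: "\<phi> c = h c" if "c \<in> children P" for c
    using iso_by_root[OF tree_poset_sub[OF P] tree_poset_sub[OF Q] \<psi>[OF that]] that
      children_verts[OF P] children_verts[OF Q] hQ[OF that]
    by (simp add: root_sub[OF P] root_sub[OF Q] \<phi> tree_posetD(4)[OF P])
  have "iso_by \<phi> P Q"
    unfolding iso_by_def
  proof (intro conjI ballI allI impI)
    have "bij_betw \<phi> {x. (c, x) \<in> le P} {x. (h c, x) \<in> le Q}" if "c \<in> children P" for c
      using iso_byD(1)[OF \<psi>[OF that]] \<phi>[OF that] by (subst bij_betw_cong[of _ \<phi> "\<psi> c"]) auto
    moreover have "disjoint_family_on (\<lambda>c. {x. (h c, x) \<in> le Q}) (children P)"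
      using verts_decomp(3)[OF Q] h unfolding disjoint_family_on_def bij_betw_def inj_on_def by blast
    ultimately have "bij_betw \<phi> (\<Union>c\<in>children P. {x. (c, x) \<in> le P}) (\<Union>c\<in>children P. {x. (h c, x) \<in> le Q})"
      by (intro bij_betw_UNION_disjoint)
    also have "(\<Union>c\<in>children P. {x. (h c, x) \<in> le Q}) = (\<Union>d\<in>children Q. {x. (d, x) \<in> le Q})"
      using h by (simp add: bij_betw_def image_image flip: bij_betw_imp_surj_on[OF h])
    finally show "bij_betw \<phi> (verts P) (verts Q)"
      using verts_decomp(1,2)[OF P] verts_decomp(1,2)[OF Q] notIn_Un_bij_betw[of "root P" _ \<phi>] \<phi>r by simp
  next
    fix x y assume xy: "x \<in> verts P" "y \<in> verts P"
    \<comment> \<open>The root is below everything and above only itself; other vertices are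
      compared through \<open>\<psi>\<close> inside one branch and are incomparable across different
      branches.\<close>
    consider "x = root P" | "x \<noteq> root P" "y = root P" | "x \<noteq> root P" "y \<noteq> root P" by blast
    then show "(x, y) \<in> le P \<longleftrightarrow> (\<phi> x, \<phi> y) \<in> le Q"
    proof cases
      case 1
      then have "\<phi> y \<in> verts Q"
        using \<phi>r root_least[OF Q] child_exists[OF P xy(2)] \<phi>h tree_posetD(3)[OF Q] by metis
      then show ?thesis using 1 root_least[OF P] root_least[OF Q] xy by (simp add: \<phi>r)
    next
      case 2
      obtain c where c: "c \<in> children P" "(c, x) \<in> le P" using child_exists[OF P xy(1)] 2 by blast
      have "(\<phi> x, root Q) \<notin> le Q"
        using child_not_root[OF Q hQ[OF c(1)]] \<phi>h[OF c] tree_posetD(5)[OF Q] by blast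
      then show ?thesis using 2 le_root[OF P] by (auto simp: \<phi>r)
    next
      case 3
      obtain c where c: "c \<in> children P" "(c, x) \<in> le P" using child_exists[OF P xy(1)] 3 by blast
      obtain d where d: "d \<in> children P" "(d, y) \<in> le P" using child_exists[OF P xy(2)] 3 by blast
      show ?thesis
      proof (cases "c = d")
        case True
        then have "(x, y) \<in> le P \<and> (c, x) \<in> le P \<longleftrightarrow> (\<phi> x, \<phi> y) \<in> le Q \<and> (h c, \<phi> x) \<in> le Q"
          using iso_byD(2)[OF \<psi>[OF c(1)], of x y] c d by (simp add: \<phi>)
        then show ?thesis using \<phi>h[OF c] c by blast
      next
        case False
        then have "h c \<noteq> h d" using h c d by (auto simp: bij_betw_def inj_on_def)
        then have "(\<phi> x, \<phi> y) \<notin> le Q"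
          using child_unique[OF Q hQ[OF c(1)] hQ[OF d(1)]] \<phi>h[OF c] \<phi>h[OF d] tree_posetD(5)[OF Q] by blast
        moreover have "(x, y) \<notin> le P"
          using False child_unique[OF P c(1) d(1)] c d tree_posetD(5)[OF P] by blast
        ultimately show ?thesis by blast
      qed
    qed
  next
    fix x y assume e: "(x, y) \<in> edges P"
    from P e show "col Q (\<phi> x, \<phi> y) = col P (x, y)"
    proof (cases rule: edge_cases)
      case 1
      then show ?thesis using hc by (simp add: \<phi>r \<phi>c)
    next
      case (2 c)
      have "(c, x) \<in> le P" "(x, y) \<in> le P" using 2 by (auto simp: edges_sub[OF P] edges_iff)
      then have "\<phi> x = \<psi> c x" "\<phi> y = \<psi> c y" using 2 \<phi> tree_posetD(5)[OF P] by blast+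
      then show ?thesis using iso_byD(3)[OF \<psi>[OF 2(1)] 2(2)] by simp
    qed
  qed
  then show ?thesis by (auto simp: cposet_iso_iff)
qed

lemma card_verts:
  assumes P: "tree_poset P"
  shows "card (verts P) = Suc (\<Sum>(i, t)\<in>#branch_mset P. tree_size t)"
proof -
  have fin: "finite {x. (c, x) \<in> le P}" for c
    by (rule finite_subset[OF _ tree_posetD(1)[OF P]]) (auto dest: tree_posetD(3)[OF P])
  have "card (verts P) = Suc (card (\<Union>c\<in>children P. {x. (c, x) \<in> le P}))"
    using verts_decomp(2)[OF P] finite_children[OF P] fin by (subst verts_decomp(1)[OF P]) simp
  also have "card (\<Union>c\<in>children P. {x. (c, x) \<in> le P}) = (\<Sum>c\<in>children P. card {x. (c, x) \<in> le P})"
    using verts_decomp(3)[OF P] fin finite_children[OF P]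
    by (intro card_UN_disjoint) (auto simp: disjoint_family_on_def)
  also have "\<dots> = (\<Sum>c\<in>children P. tree_size (iso_class (sub_poset P c)))"
    by (rule sum.cong) (simp_all add: tree_size_iso_class tree_poset_sub[OF P] children_verts[OF P])
  also have "\<dots> = (\<Sum>(i, t)\<in>#branch_mset P. tree_size t)"
    by (simp add: branch_mset_def multiset.map_comp comp_def sum_unfold_sum_mset)
  finally show ?thesis .
qed

section \<open>Grafting\<close>

lemma vertex_copy_eq_iff [simp]: "vertex_copy i v = vertex_copy j w \<longleftrightarrow> i = j \<and> v = w"
  by (simp add: vertex_copy_def)

lemma vertex_copy_nonzero [simp]: "vertex_copy j v \<noteq> 0" "0 \<noteq> vertex_copy j v"
  by (simp_all add: vertex_copy_def)

lemma verts_join_root: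
  "verts (join_root xs) = insert 0 {vertex_copy j v | j v. j < length xs \<and> v \<in> verts (snd (xs ! j))}"
  by (auto simp: join_root_def Let_def)

lemma le_join_root:
  "le (join_root xs) = {0} \<times> verts (join_root xs) \<union>
    {(vertex_copy j v, vertex_copy j w) | j v w. j < length xs \<and> (v, w) \<in> le (snd (xs ! j))}"
  by (fastforce simp: join_root_def Let_def)

lemma le_join_root_simps [simp]:
  "(0, y) \<in> le (join_root xs) \<longleftrightarrow> y \<in> verts (join_root xs)"
  "(vertex_copy j v, y) \<in> le (join_root xs) \<longleftrightarrow>
    (\<exists>w. y = vertex_copy j w \<and> j < length xs \<and> (v, w) \<in> le (snd (xs ! j)))"
  by (auto simp: le_join_root)

lemma col_join_root [simp]:
  "col (join_root xs) (0, vertex_copy j v) = fst (xs ! j)"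
  "col (join_root xs) (vertex_copy j v, vertex_copy j w) = col (snd (xs ! j)) (v, w)"
  by (simp_all add: join_root_def Let_def vertex_copy_def)

context
  fixes xs :: "(nat \<times> cposet) list"
  assumes trees: "\<And>x. x \<in> set xs \<Longrightarrow> tree_poset (snd x)"
begin

lemma tree_nth: "j < length xs \<Longrightarrow> tree_poset (snd (xs ! j))"
  using trees by simp

lemma tree_poset_join_root: "tree_poset (join_root xs)"
  unfolding tree_poset_iff
proof (intro conjI)
  note D = tree_posetD[OF tree_nth]
  have "verts (join_root xs) = insert 0 (\<Union>j<length xs. vertex_copy j ` verts (snd (xs ! j)))"
    by (auto simp: verts_join_root)
  then show "finite (verts (join_root xs))" by (auto intro: D)
  show "le (join_root xs) \<subseteq> verts (join_root xs) \<times> verts (join_root xs)"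
    by (fastforce simp: le_join_root verts_join_root dest: D(2,3))
  show "\<forall>x\<in>verts (join_root xs). (x, x) \<in> le (join_root xs)"
    by (auto simp: verts_join_root intro: D(4))
  show "trans (le (join_root xs))"
  proof (rule transI)
    fix x y z assume *: "(x, y) \<in> le (join_root xs)" "(y, z) \<in> le (join_root xs)"
    then have "z \<in> verts (join_root xs)"
      by (fastforce simp: le_join_root verts_join_root dest: D(2,3))
    then show "(x, z) \<in> le (join_root xs)"
      using * by (cases "x = 0") (auto simp: le_join_root intro: D(5))
  qed
  show "antisym (le (join_root xs))"
    by (rule antisymI) (auto simp: le_join_root dest: D(6))
  show "\<exists>r\<in>verts (join_root xs). \<forall>x\<in>verts (join_root xs). (r, x) \<in> le (join_root xs)"
    by (auto simp: verts_join_root)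
  show "\<forall>x y z. (y, x) \<in> le (join_root xs) \<longrightarrow> (z, x) \<in> le (join_root xs) \<longrightarrow>
      (y, z) \<in> le (join_root xs) \<or> (z, y) \<in> le (join_root xs)"
    by (fastforce simp: le_join_root verts_join_root dest: D(7) D(2))
qed

lemma root_join_root: "root (join_root xs) = 0"
  by (rule root_eqI[OF tree_poset_join_root]) (auto simp: verts_join_root)

lemma children_join_root:
  "children (join_root xs) = (\<lambda>j. vertex_copy j (root (snd (xs ! j)))) ` {..<length xs}"
proof (intro equalityI subsetI)
  fix c assume "c \<in> children (join_root xs)"
  then have c: "c \<in> verts (join_root xs)" "c \<noteq> 0"
    and min: "\<And>x. x \<in> verts (join_root xs) \<Longrightarrow> (x, c) \<in> le (join_root xs) \<Longrightarrow> x = 0 \<or> x = c"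
    unfolding children_def root_join_root mem_Collect_eq edges_iff by auto
  then obtain j v where j: "c = vertex_copy j v" "j < length xs" "v \<in> verts (snd (xs ! j))"
    by (auto simp: verts_join_root)
  \<comment> \<open>The copy of the root of the \<open>j\<close>-th tree lies between
    \<open>0\<close> and \<open>c\<close> and is not \<open>0\<close>, so it must be
    \<open>c\<close>.\<close>
  then have "vertex_copy j (root (snd (xs ! j))) = c"
    using min[of "vertex_copy j (root (snd (xs ! j)))"] root_least[OF tree_nth[OF j(2)]]
    by (auto simp: verts_join_root)
  then show "c \<in> (\<lambda>j. vertex_copy j (root (snd (xs ! j)))) ` {..<length xs}" using j(2) by auto
next
  fix c assume "c \<in> (\<lambda>j. vertex_copy j (root (snd (xs ! j)))) ` {..<length xs}"
  then obtain j where j: "j < length xs" "c = vertex_copy j (root (snd (xs ! j)))" by auto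
  then show "c \<in> children (join_root xs)"
    unfolding children_def root_join_root mem_Collect_eq edges_iff
    using root_least[OF tree_nth[OF j(1)]] le_root[OF tree_nth[OF j(1)]]
    by (auto simp: verts_join_root)
qed

lemma sub_join_root:
  assumes j: "j < length xs"
  shows "cposet_iso (snd (xs ! j)) (sub_poset (join_root xs) (vertex_copy j (root (snd (xs ! j)))))"
proof -
  let ?P = "snd (xs ! j)" and ?Q = "sub_poset (join_root xs) (vertex_copy j (root (snd (xs ! j))))"
  have "verts ?Q = vertex_copy j ` verts ?P"
    using j root_least[OF tree_nth[OF j]] tree_posetD(3)[OF tree_nth[OF j]] by auto
  then have "iso_by (vertex_copy j) ?P ?Q"
    unfolding iso_by_def using j root_least[OF tree_nth[OF j]]
    by (auto simp: bij_betw_def inj_on_def)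
  then show ?thesis by (auto simp: cposet_iso_iff)
qed

lemma branch_mset_join_root:
  "branch_mset (join_root xs) = mset (map (map_prod id iso_class) xs)"
proof -
  let ?c = "\<lambda>j. vertex_copy j (root (snd (xs ! j)))"
  have inj: "inj_on ?c {..<length xs}" by (auto simp: inj_on_def)
  have c: "?c j \<in> verts (join_root xs)" if "j < length xs" for j
    using that children_verts[OF tree_poset_join_root] by (auto simp: children_join_root)
  have "branch_mset (join_root xs) = image_mset (\<lambda>j. (fst (xs ! j), iso_class (sub_poset (join_root xs) (?c j)))) (mset_set {..<length xs})"
    by (simp add: branch_mset_def children_join_root root_join_root flip: image_mset_mset_set[OF inj])
      (simp add: multiset.map_comp comp_def)
  also have "\<dots> = image_mset (\<lambda>j. map_prod id iso_class (xs ! j)) (mset_set {..<length xs})"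
  proof (rule image_mset_cong)
    fix j assume "j \<in># mset_set {..<length xs}"
    then have j: "j < length xs" by simp
    then show "(fst (xs ! j), iso_class (sub_poset (join_root xs) (?c j))) = map_prod id iso_class (xs ! j)"
      using iso_class_eq_iff[OF tree_nth[OF j] tree_poset_sub[OF tree_poset_join_root c[OF j]]] sub_join_root[OF j]
      by (simp add: prod_eq_iff)
  qed
  also have "\<dots> = mset (map (\<lambda>j. map_prod id iso_class (xs ! j)) [0..<length xs])"
    by (simp add: lessThan_atLeast0 mset_set_upto_eq_mset_upto)
  also have "map (\<lambda>j. map_prod id iso_class (xs ! j)) [0..<length xs] = map (map_prod id iso_class) xs"
    by (rule nth_equalityI) simp_all
  finally show ?thesis .
qed

end

section \<open>Colours, and grafting as a bijection\<close>

definition coloured_in :: "nat set \<Rightarrow> cposet \<Rightarrow> bool" where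
  "coloured_in C P \<longleftrightarrow> col P ` edges P \<subseteq> C"

lemma trees_iff: "t \<in> trees n \<longleftrightarrow> (\<exists>P. t = iso_class P \<and> tree_poset P \<and> coloured_in {1..n} P)"
  by (auto simp: trees_def coloured_in_def)

lemma coloured_in_iso:
  assumes P: "tree_poset P" and Q: "tree_poset Q" and "cposet_iso P Q" and C: "coloured_in C Q"
  shows "coloured_in C P"
proof -
  obtain \<phi> where i: "iso_by \<phi> P Q" using assms(3) by (auto simp: cposet_iso_iff)
  have "col P (x, y) \<in> C" if e: "(x, y) \<in> edges P" for x y
  proof -
    have "x \<in> verts P" "y \<in> verts P" using e P by (auto simp: edges_iff dest: tree_posetD)
    then have "(\<phi> x, \<phi> y) \<in> edges Q" using iso_by_edges[OF P Q i] e by simp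
    then show ?thesis using iso_byD(3)[OF i e] C by (auto simp: coloured_in_def)
  qed
  then show ?thesis by (auto simp: coloured_in_def)
qed

lemma iso_class_in_trees_iff:
  assumes "tree_poset P"
  shows "iso_class P \<in> trees n \<longleftrightarrow> coloured_in {1..n} P"
  using assms coloured_in_iso iso_class_eq_iff unfolding trees_iff by metis

text \<open>Every edge either joins the root to a child or lies inside a branch, so the bound on
  colours can be checked on these two kinds separately.\<close>

lemma branch_mset_trees_iff:
  assumes P: "tree_poset P"
  shows "set_mset (branch_mset P) \<subseteq> {1..n} \<times> trees n \<longleftrightarrow> coloured_in {1..n} P"
proof -
  have "coloured_in {1..n} P \<longleftrightarrow>
      (\<forall>c\<in>children P. col P (root P, c) \<in> {1..n} \<and> coloured_in {1..n} (sub_poset P c))"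
  proof
    assume "coloured_in {1..n} P"
    then show "\<forall>c\<in>children P. col P (root P, c) \<in> {1..n} \<and> coloured_in {1..n} (sub_poset P c)"
      by (auto simp: coloured_in_def children_def edges_sub[OF P] image_subset_iff simp del: atLeastAtMost_iff)
  next
    assume R: "\<forall>c\<in>children P. col P (root P, c) \<in> {1..n} \<and> coloured_in {1..n} (sub_poset P c)"
    have "col P (x, y) \<in> {1..n}" if "(x, y) \<in> edges P" for x y
      using P that
    proof (cases rule: edge_cases)
      case 1
      then show ?thesis using R by blast
    next
      case (2 c)
      then have "coloured_in {1..n} (sub_poset P c)" using R by blast
      then show ?thesis using 2(2) by (auto simp: coloured_in_def image_subset_iff simp del: atLeastAtMost_iff)
    qed
    then show "coloured_in {1..n} P" by (auto simp: coloured_in_def simp del: atLeastAtMost_iff)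
  qed
  also have "\<dots> \<longleftrightarrow> (\<forall>c\<in>children P. (col P (root P, c), iso_class (sub_poset P c)) \<in> {1..n} \<times> trees n)"
    by (intro ball_cong) (simp_all add: iso_class_in_trees_iff tree_poset_sub[OF P] children_verts[OF P])
  also have "\<dots> \<longleftrightarrow> set_mset (branch_mset P) \<subseteq> {1..n} \<times> trees n"
    unfolding branch_mset_def using finite_children[OF P] by (auto simp del: atLeastAtMost_iff)
  finally show ?thesis by blast
qed

text \<open>The choice of a listing is the one made in \<open>branches\<close>, but as a function of
  the multiset alone, so grafting factors through the tagged encoding. \<open>branch_mset\<close>
  does not see the order chosen.\<close>

definition graft_poset :: "(nat \<times> ctree) multiset \<Rightarrow> cposet" where
  "graft_poset M = join_root (map (map_prod id rep) (SOME xs. mset xs = M))"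

lemma graft_eq: "graft n f = iso_class (graft_poset (\<Sum>i\<in>{1..n}. image_mset (Pair i) (f i)))"
  by (simp add: graft_def graft_poset_def branches_def)

lemma graft_poset:
  assumes M: "set_mset M \<subseteq> A \<times> trees n"
  shows "tree_poset (graft_poset M)" "branch_mset (graft_poset M) = M"
proof -
  define xs where "xs = (SOME xs. mset xs = M)"
  have xs: "mset xs = M" unfolding xs_def using ex_mset[of M] by (rule someI_ex)
  have rep: "tree_poset (rep t) \<and> iso_class (rep t) = t" if "t \<in> trees n" for t
    using that rep_iso_class by (auto simp: trees_iff)
  have xsM: "set xs \<subseteq> A \<times> trees n" using M xs by auto
  have trees: "tree_poset (snd x)" if "x \<in> set (map (map_prod id rep) xs)" for x
    using that rep xsM by auto
  show "tree_poset (graft_poset M)"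
    unfolding graft_poset_def xs_def[symmetric] by (rule tree_poset_join_root[OF trees])
  have "branch_mset (graft_poset M) = mset (map (map_prod id iso_class) (map (map_prod id rep) xs))"
    unfolding graft_poset_def xs_def[symmetric] by (rule branch_mset_join_root[OF trees])
  also have "map (map_prod id iso_class) (map (map_prod id rep) xs) = xs"
    using rep xsM by (auto intro!: map_idI)
  finally show "branch_mset (graft_poset M) = M" using xs by simp
qed

text \<open>The inverse is \<open>branch_mset\<close>. It recovers \<open>M\<close> from the grafted
  poset, and any \<open>P\<close> is isomorphic to the graft of its own branches because the two
  have the same branches.\<close>

lemma bij_betw_graft_poset:
  "bij_betw (\<lambda>M. iso_class (graft_poset M)) {M. set_mset M \<subseteq> {1..n} \<times> trees n} (trees n)"
  unfolding bij_betw_def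
proof (intro conjI equalityI subsetI inj_onI)
  fix M N assume "M \<in> {M. set_mset M \<subseteq> {1..n} \<times> trees n}" "N \<in> {M. set_mset M \<subseteq> {1..n} \<times> trees n}"
    and eq: "iso_class (graft_poset M) = iso_class (graft_poset N)"
  then have "set_mset M \<subseteq> {1..n} \<times> trees n" "set_mset N \<subseteq> {1..n} \<times> trees n" by auto
  note MN = graft_poset[OF this(1)] graft_poset[OF this(2)]
  show "M = N"
    using branch_mset_iso[OF MN(1,3)] eq iso_class_eq_iff[OF MN(1,3)] MN(2,4) by simp
next
  fix t assume "t \<in> (\<lambda>M. iso_class (graft_poset M)) ` {M. set_mset M \<subseteq> {1..n} \<times> trees n}"
  then obtain M where M: "set_mset M \<subseteq> {1..n} \<times> trees n" "t = iso_class (graft_poset M)" by auto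
  then show "t \<in> trees n"
    using branch_mset_trees_iff[OF graft_poset(1)[OF M(1)]] graft_poset[OF M(1)]
    by (simp add: iso_class_in_trees_iff)
next
  fix t assume "t \<in> trees n"
  then obtain P where P: "t = iso_class P" "tree_poset P" "coloured_in {1..n} P"
    by (auto simp: trees_iff)
  then have M: "set_mset (branch_mset P) \<subseteq> {1..n} \<times> trees n"
    using branch_mset_trees_iff[OF P(2)] by blast
  have "cposet_iso P (graft_poset (branch_mset P))"
    using P(2) graft_poset[OF M] by (intro cposet_iso_if_branch_mset_eq) auto
  then show "t \<in> (\<lambda>M. iso_class (graft_poset M)) ` {M. set_mset M \<subseteq> {1..n} \<times> trees n}"
    using P graft_poset(1)[OF M] M iso_class_eq_iff by blast
qed

lemma tree_size_graft_poset:
  assumes "set_mset M \<subseteq> A \<times> trees n"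
  shows "tree_size (iso_class (graft_poset M)) = Suc (\<Sum>(i, t)\<in>#M. tree_size t)"
  using card_verts[OF graft_poset(1)[OF assms]] graft_poset[OF assms]
  by (simp add: tree_size_iso_class)

section \<open>The inductive formula\<close>

text \<open>Distributing the product over its factors produces one summand per choice function, that
  is, the simultaneous Sweedler expansion of \<open>coproduct_formula\<close>.\<close>

lemma prod_tag:
  fixes x :: "'c \<Rightarrow> ('a multiset \<times> 'a multiset \<Rightarrow>\<^sub>0 'k::comm_ring_1)"
  assumes "finite J"
  shows "(\<Prod>i\<in>J. tag i (x i)) = (\<Sum>p\<in>(\<Pi>\<^sub>E i\<in>J. keys (x i)). (\<Prod>i\<in>J. lookup (x i) (p i)) *\<^sub>k
      basis (\<Sum>i\<in>J. image_mset (Pair i) (fst (p i)), \<Sum>i\<in>J. image_mset (Pair i) (snd (p i))))"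
proof -
  have smul: "(\<Prod>i\<in>J. c i *\<^sub>k y i) = (\<Prod>i\<in>J. c i) *\<^sub>k (\<Prod>i\<in>J. y i)"
    for c :: "'c \<Rightarrow> 'k" and y :: "'c \<Rightarrow> ('b::comm_monoid_add \<Rightarrow>\<^sub>0 'k)"
    by (induction J rule: infinite_finite_induct) (simp_all add: smul_mult mult_smul mult_ac)
  have "tag i (x i) = (\<Sum>a\<in>keys (x i). lookup (x i) a *\<^sub>k
      basis (image_mset (Pair i) (fst a), image_mset (Pair i) (snd a)))" for i
    by (simp add: tag_def lin_ext_def case_prod_unfold)
  then show ?thesis
    using assms by (simp add: prod_sum_PiE smul sum_prod flip: basis_sum)
qed

context coloured_trees
begin

lemma cop_tuple_sum:
  "cop_tuple (\<Sum>i\<in>J. image_mset (Pair i) (f i)) = (\<Prod>i\<in>J. tag i (cop_forest (f i)))"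
  by (induction J rule: infinite_finite_induct) (simp_all add: cop_tuple_simps cop_tuple_tag)

lemma twist_sum:
  "twist q (\<Sum>i\<in>J. image_mset (Pair i) (f i)) = (\<Prod>i\<in>J. q i ^ weight (f i)) *\<^sub>k (\<Prod>i\<in>J. basis (f i))"
  by (induction J rule: infinite_finite_induct)
    (simp_all add: twist_simps twist_tag smul_mult mult_smul mult.commute)

end

text \<open>Sorting by tag recovers a tuple from any tagged multiset, so every tree is
  \<open>\<lambda>\<close> of some tuple of forests.\<close>

lemma tuple_of_mset:
  assumes "finite J" "set_mset M \<subseteq> J \<times> A"
  shows "(\<Sum>i\<in>J. image_mset (Pair i) (image_mset snd (filter_mset (\<lambda>p. fst p = i) M))) = M"
  using assms(2)
proof (induction M)
  case empty
  then show ?case by simp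
next
  case (add p M)
  obtain j t where p: "p = (j, t)" by force
  have "(\<Sum>i\<in>J. image_mset (Pair i) (image_mset snd (filter_mset (\<lambda>p. fst p = i) (add_mset p M)))) =
      (\<Sum>i\<in>J. image_mset (Pair i) (image_mset snd (filter_mset (\<lambda>p. fst p = i) M)) + (if j = i then {#p#} else {#}))"
    by (rule sum.cong) (auto simp: p)
  also have "\<dots> = add_mset p M"
    using add assms(1) by (simp add: sum.distrib p)
  finally show ?case .
qed

text \<open>The formula prescribes values on single trees only. Uniqueness is therefore claimed
  among linear multiplicative maps, for which the values on trees determine all others.\<close>

theorem theorem4p2:
  fixes n :: nat and q1 q2 :: "nat \<Rightarrow> 'k::field_char_0"
  shows "\<exists>\<Delta> \<epsilon> S.
    graded_connected_hopf_algebra (forests n) forest_size \<Delta> \<epsilon> S \<and>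
    coproduct_formula n q1 q2 \<Delta> \<and>
    (\<forall>\<Delta>' :: (cforest \<Rightarrow>\<^sub>0 'k) \<Rightarrow> ((cforest \<times> cforest) \<Rightarrow>\<^sub>0 'k).
       linear_map_on (symm_alg n) \<Delta>' \<and> multiplicative_on (symm_alg n) \<Delta>' \<and>
       coproduct_formula n q1 q2 \<Delta>' \<longrightarrow> (\<forall>x\<in>symm_alg n. \<Delta>' x = \<Delta> x))"
proof -
  interpret coloured_trees "{1..n}" "trees n" "\<lambda>M. iso_class (graft_poset M)" tree_size q1 q2
    by unfold_locales (use bij_betw_graft_poset tree_size_graft_poset in blast)+
  let ?tuple = "\<lambda>f. \<Sum>i\<in>{1..n}. image_mset (Pair i) (f i)"
  have size: "forest_size F = weight F" for F by (simp add: forest_size_def)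
  have forests: "F \<in> forests n \<longleftrightarrow> set_mset F \<subseteq> trees n" for F by (simp add: forests_def)
  have lam: "lam n f = join (?tuple f)" for f by (simp add: lam_def join_def graft_eq)
  \<comment> \<open>Proved for arbitrary \<open>\<Delta>\<close>, since it serves both existence and
    uniqueness: it collapses the two Sweedler sums into \<open>cocycle\<close> applied to a product
    of tagged coproducts.\<close>
  have formula_iff: "coproduct_formula n q1 q2 \<Delta> \<longleftrightarrow>
      (\<forall>f. (\<forall>i\<in>{1..n}. f i \<in> forests n) \<longrightarrow>
        \<Delta> (lam n f) = lin_ext cocycle (\<Prod>i\<in>{1..n}. tag i (\<Delta> (basis (f i)))))" for \<Delta>
    unfolding coproduct_formula_def Let_def
    by (simp only: prod_tag finite_atLeastAtMost lin_ext_sum lin_ext_smul lin_ext_basis cocycle_def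
        prod.case twist_sum lam size smul_add sum.distrib)
  have "graded_connected_hopf_algebra (forests n) forest_size (lin_ext cop_forest) (\<lambda>x. lookup x 0) (lin_ext antipode)"
    using graded_connected_hopf_algebra by (simp add: forests_def forest_size_def[abs_def])
  moreover have "coproduct_formula n q1 q2 (lin_ext cop_forest)"
    unfolding formula_iff
  proof (intro allI impI)
    fix f assume f: "\<forall>i\<in>{1..n}. f i \<in> forests n"
    have "set_mset (?tuple f) \<subseteq> {1..n} \<times> trees n"
      using f by (auto simp: forests set_mset_sum simp del: atLeastAtMost_iff)
    then show "lin_ext cop_forest (lam n f) =
        lin_ext cocycle (\<Prod>i\<in>{1..n}. tag i (lin_ext cop_forest (basis (f i))))"
      unfolding lam lin_ext_basis cop_tuple_sum[symmetric] by (rule cop_join)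
  qed
  moreover have "\<Delta>' x = lin_ext cop_forest x"
    if lin: "linear_map_on (symm_alg n) \<Delta>'" and mult: "multiplicative_on (symm_alg n) \<Delta>'"
      and formula: "coproduct_formula n q1 q2 \<Delta>'" and x: "x \<in> symm_alg n"
    for \<Delta>' :: "(cforest \<Rightarrow>\<^sub>0 'k) \<Rightarrow> ((cforest \<times> cforest) \<Rightarrow>\<^sub>0 'k)" and x
  proof -
    have B: "basis F \<in> symm_alg n \<longleftrightarrow> set_mset F \<subseteq> trees n" for F
      by (simp add: symm_alg_def forests)
    \<comment> \<open>Agreement is assumed only on the trees of \<open>F\<close>, so that the claim
      can be used inside the induction on tree size for forests of smaller trees.\<close>
    have forest: "\<Delta>' (basis F) = cop_forest F"
      if "set_mset F \<subseteq> trees n" "\<And>t. t \<in># F \<Longrightarrow> \<Delta>' (basis {#t#}) = cop t" for F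
      using that
    proof (induction F)
      case empty
      then show ?case using mult by (simp add: multiplicative_on_def cop_forest_simps basis_zero del: One_nat_def)
    next
      case (add t F)
      have "\<Delta>' (basis {#t#} * basis F) = \<Delta>' (basis {#t#}) * \<Delta>' (basis F)"
        using mult add.prems(1) by (auto simp: multiplicative_on_def B)
      then show ?case using add by (simp add: cop_forest_simps del: One_nat_def flip: basis_add)
    qed
    have tree: "\<Delta>' (basis {#t#}) = cop t" if "t \<in> trees n" for t
      using that
    proof (induction "tree_size t" arbitrary: t rule: less_induct)
      case less
      obtain M where M: "set_mset M \<subseteq> {1..n} \<times> trees n" "t = iso_class (graft_poset M)"
        using less.prems by (rule tree_cases)
      define f where "f i = image_mset snd (filter_mset (\<lambda>p. fst p = i) M)" for i
      have tuple: "?tuple f = M"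
        using tuple_of_mset[OF _ M(1)] by (simp add: f_def)
      have f: "set_mset (f i) \<subseteq> trees n" for i
        using M(1) by (auto simp: f_def)
      have "\<Delta>' (basis (f i)) = cop_forest (f i)" for i
      proof (rule forest[OF f])
        fix s assume s: "s \<in># f i"
        then have "(i, s) \<in># M" by (auto simp: f_def)
        then show "\<Delta>' (basis {#s#}) = cop s"
          using wt_child[OF M(1)] M(2) by (intro less.hyps) auto
      qed
      then have "\<Delta>' (lam n f) = lin_ext cocycle (\<Prod>i\<in>{1..n}. tag i (cop_forest (f i)))"
        using formula f by (simp add: formula_iff forests del: One_nat_def)
      then show ?case
        by (simp add: lam tuple join_def M(2) cop_B[OF M(1)] del: One_nat_def flip: cop_tuple_sum)
    qed
    \<comment> \<open>Here \<open>\<Delta>'\<close> is linear on \<open>symm_alg n\<close> only, so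
      membership of the partial sums has to be carried along. The empty sum is treated as
      \<open>0 *\<^sub>k 0\<close>.\<close>
    have "\<Delta>' (\<Sum>b\<in>J. c b *\<^sub>k basis b) = (\<Sum>b\<in>J. c b *\<^sub>k \<Delta>' (basis b))"
      if "finite J" "\<And>b. b \<in> J \<Longrightarrow> set_mset b \<subseteq> trees n" for J c
      using that
    proof (induction J rule: finite_induct)
      case empty
      have "\<Delta>' (0 *\<^sub>k 0) = 0 *\<^sub>k \<Delta>' 0"
        using lin free_mod_zero unfolding linear_map_on_def symm_alg_def by blast
      then show ?case by simp
    next
      case (insert a J)
      have "c a *\<^sub>k basis a \<in> symm_alg n" "(\<Sum>b\<in>J. c b *\<^sub>k basis b) \<in> symm_alg n" "(basis a :: cforest \<Rightarrow>\<^sub>0 'k) \<in> symm_alg n"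
        using insert.prems by (auto simp: symm_alg_def forests intro!: free_mod_smul free_mod_sum)
      then show ?case using lin insert by (simp add: linear_map_on_def)
    qed
    moreover have keys: "set_mset b \<subseteq> trees n" if "b \<in> keys x" for b
      using x that by (auto simp: symm_alg_def free_mod_def forests_def)
    ultimately have "\<Delta>' (lin_ext basis x) = lin_ext (\<lambda>b. \<Delta>' (basis b)) x"
      by (simp add: lin_ext_def)
    also have "\<dots> = lin_ext cop_forest x"
      by (intro lin_ext_cong refl forest tree) (use keys in auto)
    finally show ?thesis by (simp add: lin_ext_basis_id)
  qed
  ultimately show ?thesis by blast
qed

end
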